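(* Let $\mathcal H$ be a reproducing kernel Hilbert space on a set $\Omega$ whose kernel is a normalized complete Nevanlinna--Pick kernel. If $(f_n)_{n=1}^\infty$ is a sequence in $\mathcal H$ with $\sum_{n=1}^\infty \|f_n\|_{\mathcal H}^2<\infty$, then there exist a sequence $(\varphi_n)_{n=1}^\infty\subset \mathrm{Mult}(\mathcal H)$ and a cyclic vector $F\in\mathcal H$ such that (i) $\|F\|_{\mathcal H}^2\leq \sum_{n=1}^\infty \|f_n\|_{\mathcal H}^2$; (ii) the column $\begin{pmatrix}\varphi_1\\ \varphi_2\\ \vdots\end{pmatrix}$ is contractive; (iii) $f_n=\varphi_n F$ for all $n$.
   Context: A normalized complete Nevanlinna--Pick (CNP) kernel on a set $\Omega$ is a function $k:\Omega\times\Omega\to\mathbb C$ of the form $$k(x,y)=\frac{1}{1-u(x)u(y)^*},\qquad u(x)u(y)^*=\sum_{n} u_n(x)\overline{u_n(y)},$$ where $u$ is any function from $\Omega$ into the open unit ball $\mathbb B^d$ of $\mathbb C^d$; $d=\infty$ is allowed, in which case $u$ maps $\Omega$ into $\ell^2(\mathbb N)$ with $\|u(x)\|^2=\sum_{n=1}^\infty|u_n(x)|^2<1$ for all $x\in\Omega$. The space $\mathcal H=\mathcal H(k)$ is the Hilbert space of complex-valued functions on $\Omega$ with reproducing kernel $k$. $\mathrm{Mult}(\mathcal H)$ denotes the algebra of functions $\varphi:\Omega\to\mathbb C$ such that $\varphi g\in\mathcal H$ for every $g\in\mathcal H$. A vector $F\in\mathcal H$ is cyclic if $\{\varphi F:\varphi\in\mathrm{Mult}(\mathcal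 H)\}$ is dense in $\mathcal H$. A column $(\varphi_n)$ of multipliers is contractive if the column operator $g\mapsto(\varphi_1 g,\varphi_2 g,\dots)^T$ is a contraction from $\mathcal H$ to $\mathcal H\otimes\ell^2$, i.e. $\sum_{n=1}^\infty\|\varphi_n g\|_{\mathcal H}^2\le\|g\|_{\mathcal H}^2$ for all $g\in\mathcal H$.
   Formalization: The sequence (f_n) is additionally assumed not to be identically zero: if all f_n = 0 and Ω is non-empty, (i) forces F = 0, which is not cyclic since H contains non-zero kernel functions. *)

theory Defs
  imports "HOL-Analysis.Analysis" "HOL-Library.Extended_Nat"
begin

text \<open>
  A complex-valued function on a set \<open>\<Omega>\<close> is encoded as a total function that vanishes
  outside \<open>\<Omega>\<close>, so that equality and the pointwise operations are those on \<open>\<Omega>\<close>.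
\<close>

definition functions_on :: "'a set \<Rightarrow> ('a \<Rightarrow> complex) set" where
  "functions_on \<Omega> = {f. \<forall>x. x \<notin> \<Omega> \<longrightarrow> f x = 0}"

definition hs_norm :: "(('a \<Rightarrow> complex) \<Rightarrow> ('a \<Rightarrow> complex) \<Rightarrow> complex) \<Rightarrow> ('a \<Rightarrow> complex) \<Rightarrow> real" where
  "hs_norm ip f = sqrt (Re (ip f f))"

text \<open>
  A Hilbert space of functions is a carrier \<open>H\<close> with an inner product \<open>ip\<close> (linear in the
  first argument). The values of \<open>ip\<close> outside \<open>H\<close> are irrelevant.
\<close>

definition hilbert_function_space ::
  "'a set \<Rightarrow> ('a \<Rightarrow> complex) set \<Rightarrow> (('a \<Rightarrow> complex) \<Rightarrow> ('a \<Rightarrow> complex) \<Rightarrow> complex) \<Rightarrow> bool" where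
  "hilbert_function_space \<Omega> H ip \<longleftrightarrow>
     H \<subseteq> functions_on \<Omega> \<and>
     (\<lambda>x. 0) \<in> H \<and>
     (\<forall>f\<in>H. \<forall>g\<in>H. (\<lambda>x. f x + g x) \<in> H) \<and>
     (\<forall>c. \<forall>f\<in>H. (\<lambda>x. c * f x) \<in> H) \<and>
     (\<forall>f\<in>H. \<forall>g\<in>H. \<forall>h\<in>H. ip (\<lambda>x. f x + g x) h = ip f h + ip g h) \<and>
     (\<forall>c. \<forall>f\<in>H. \<forall>g\<in>H. ip (\<lambda>x. c * f x) g = c * ip f g) \<and>
     (\<forall>f\<in>H. \<forall>g\<in>H. ip g f = cnj (ip f g)) \<and>
     (\<forall>f\<in>H. 0 \<le> Re (ip f f)) \<and>
     (\<forall>f\<in>H. ip f f = 0 \<longrightarrow> f = (\<lambda>x. 0)) \<and>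
     (\<forall>s :: nat \<Rightarrow> 'a \<Rightarrow> complex.
        (\<forall>n. s n \<in> H) \<and>
        (\<forall>e>0. \<exists>N. \<forall>m\<ge>N. \<forall>n\<ge>N. hs_norm ip (\<lambda>x. s m x - s n x) < e) \<longrightarrow>
        (\<exists>l\<in>H. (\<lambda>n. hs_norm ip (\<lambda>x. s n x - l x)) \<longlonglongrightarrow> 0))"

definition kernel_function :: "'a set \<Rightarrow> ('a \<Rightarrow> 'a \<Rightarrow> complex) \<Rightarrow> 'a \<Rightarrow> 'a \<Rightarrow> complex" where
  "kernel_function \<Omega> k y = (\<lambda>x. if x \<in> \<Omega> then k x y else 0)"

definition rkhs ::
  "'a set \<Rightarrow> ('a \<Rightarrow> 'a \<Rightarrow> complex) \<Rightarrow> ('a \<Rightarrow> complex) set \<Rightarrow>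
   (('a \<Rightarrow> complex) \<Rightarrow> ('a \<Rightarrow> complex) \<Rightarrow> complex) \<Rightarrow> bool" where
  "rkhs \<Omega> k H ip \<longleftrightarrow>
     hilbert_function_space \<Omega> H ip \<and>
     (\<forall>y\<in>\<Omega>. kernel_function \<Omega> k y \<in> H \<and> (\<forall>f\<in>H. f y = ip f (kernel_function \<Omega> k y)))"

text \<open>
  The dimension \<open>d\<close> may be infinite. Coordinates are indexed by the \<open>n < d\<close>, starting
  at 0; for \<open>d = \<infinity>\<close> the condition says that \<open>u\<close> maps \<open>\<Omega>\<close> into the open unit ball
  of the sequence space \<open>l\<^sup>2\<close>.
\<close>

definition maps_to_ball :: "'a set \<Rightarrow> enat \<Rightarrow> ('a \<Rightarrow> nat \<Rightarrow> complex) \<Rightarrow> bool" where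
  "maps_to_ball \<Omega> d u \<longleftrightarrow>
     (\<forall>x\<in>\<Omega>. (\<lambda>n. (cmod (u x n))\<^sup>2) summable_on {n. enat n < d} \<and>
            (\<Sum>\<^sub>\<infinity>n\<in>{n. enat n < d}. (cmod (u x n))\<^sup>2) < 1)"

definition normalized_cnp_kernel :: "'a set \<Rightarrow> ('a \<Rightarrow> 'a \<Rightarrow> complex) \<Rightarrow> bool" where
  "normalized_cnp_kernel \<Omega> k \<longleftrightarrow>
     (\<exists>d u. maps_to_ball \<Omega> d u \<and>
        (\<forall>x\<in>\<Omega>. \<forall>y\<in>\<Omega>. k x y = 1 / (1 - (\<Sum>\<^sub>\<infinity>n\<in>{n. enat n < d}. u x n * cnj (u y n)))))"

definition multipliers :: "'a set \<Rightarrow> ('a \<Rightarrow> complex) set \<Rightarrow> ('a \<Rightarrow> complex) set" where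
  "multipliers \<Omega> H = {\<phi> \<in> functions_on \<Omega>. \<forall>g\<in>H. (\<lambda>x. \<phi> x * g x) \<in> H}"

definition cyclic_vector ::
  "'a set \<Rightarrow> ('a \<Rightarrow> complex) set \<Rightarrow> (('a \<Rightarrow> complex) \<Rightarrow> ('a \<Rightarrow> complex) \<Rightarrow> complex) \<Rightarrow>
   ('a \<Rightarrow> complex) \<Rightarrow> bool" where
  "cyclic_vector \<Omega> H ip F \<longleftrightarrow>
     F \<in> H \<and>
     (\<forall>g\<in>H. \<forall>e>0. \<exists>\<phi>\<in>multipliers \<Omega> H. hs_norm ip (\<lambda>x. g x - \<phi> x * F x) < e)"

definition contractive_column ::
  "('a \<Rightarrow> complex) set \<Rightarrow> (('a \<Rightarrow> complex) \<Rightarrow> ('a \<Rightarrow> complex) \<Rightarrow> complex) \<Rightarrow>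
   (nat \<Rightarrow> 'a \<Rightarrow> complex) \<Rightarrow> bool" where
  "contractive_column H ip \<phi> \<longleftrightarrow>
     (\<forall>g\<in>H. summable (\<lambda>n. (hs_norm ip (\<lambda>x. \<phi> n x * g x))\<^sup>2) \<and>
            (\<Sum>n. (hs_norm ip (\<lambda>x. \<phi> n x * g x))\<^sup>2) \<le> (hs_norm ip g)\<^sup>2)"

end

theory Submission
  imports Defs
begin

text \<open>
  The factorization is a shadow of inner-outer factorization in the full Fock space, where the
  variables do not commute and the shift is a row of isometries with orthogonal ranges.

  Expanding \<open>1 / (1 - \<langle>u x, u y\<rangle>)\<close> as a geometric series over words \<open>w\<close> writes the kernel
  \<open>k x y\<close> as \<open>\<Sum>w. u(x)\<^sup>w cnj (u(y)\<^sup>w)\<close>, so \<open>k\<close> has the Gram matrix of the vectors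
  \<open>(cnj (u(x)\<^sup>w))\<^sub>w\<close> in \<open>l\<^sup>2\<close> of words. Hence evaluation \<open>F \<mapsto> (x \<mapsto> \<Sum>w. F w * u(x)\<^sup>w)\<close> maps \<open>l\<^sup>2\<close>
  contractively onto \<open>H\<close>, and every function in \<open>H\<close> has a preimage of norm at most its own
  (lemmas \<open>descend_contraction\<close> and \<open>contractive_lift\<close>). Evaluation turns the convolution of
  words into the product of functions (\<open>descend_conv\<close>).

  A sequence \<open>(a\<^sub>n)\<close> of elements of \<open>l\<^sup>2\<close> with summable squared norms is stored in the single element
  \<open>A\<close> with \<open>A (n # w) = a\<^sub>n w\<close> and \<open>A [] = 0\<close>. Right convolution acts on all the \<open>a\<^sub>n\<close> at once,
  because it leaves the first letter of a non-empty word alone. So it suffices to factor \<open>A\<close>.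

  For nonzero \<open>f\<close> in \<open>l\<^sup>2\<close>, let \<open>M\<close> be the closed right-invariant subspace generated by \<open>f\<close>, and
  \<open>\<theta>\<close> the normalized component of \<open>f\<close> orthogonal to all \<open>conv f c\<close> with \<open>c [] = 0\<close>. It is nonzero,
  since a word of minimal length in the support of \<open>f\<close> is outside the support of every such
  \<open>conv f c\<close>. The right translates of \<open>\<theta>\<close> are orthonormal, so \<open>G \<mapsto> conv \<theta> G\<close> is an isometry, and
  they span \<open>M\<close> because a vector of \<open>M\<close> orthogonal to them stays so when a letter is removed on
  the right, and its coefficient at \<open>[]\<close> is \<open>0\<close>. Therefore \<open>f = conv \<theta> F\<close> with \<open>F\<close> of the norm of
  \<open>f\<close>, and \<open>F\<close> is cyclic since \<open>\<theta>\<close> is in \<open>M\<close> (theorem \<open>inner_outer_factorization\<close>).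

  For \<open>f = A\<close>, the slices of \<open>\<theta>\<close> descend to the multipliers \<open>\<phi>\<^sub>n\<close>: the column is contractive
  because the lift, convolution by \<open>\<theta>\<close> and evaluation are contractive. The function \<open>F\<close> descends
  to the cyclic vector.
\<close>

section \<open>Orthogonal projection in a Hilbert space of functions\<close>

text \<open>
  Orthogonal projection is needed both in \<open>H\<close> and in \<open>l\<^sup>2\<close>. Treating both as instances of the same
  predicate on spaces of functions makes one development serve for the two.
\<close>

locale hilbert_fun =
  fixes \<Omega> :: "'a set" and H :: "('a \<Rightarrow> complex) set"
    and ip :: "('a \<Rightarrow> complex) \<Rightarrow> ('a \<Rightarrow> complex) \<Rightarrow> complex"
  assumes hilbert: "hilbert_function_space \<Omega> H ip"
begin

abbreviation nrm :: "('a \<Rightarrow> complex) \<Rightarrow> real" where "nrm \<equiv> hs_norm ip"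

lemma zero_in: "(\<lambda>x. 0) \<in> H"
  and add_in: "f \<in> H \<Longrightarrow> g \<in> H \<Longrightarrow> (\<lambda>x. f x + g x) \<in> H"
  and scale_in: "f \<in> H \<Longrightarrow> (\<lambda>x. c * f x) \<in> H"
  and ip_add: "f \<in> H \<Longrightarrow> g \<in> H \<Longrightarrow> h \<in> H \<Longrightarrow> ip (\<lambda>x. f x + g x) h = ip f h + ip g h"
  and ip_scale: "f \<in> H \<Longrightarrow> g \<in> H \<Longrightarrow> ip (\<lambda>x. c * f x) g = c * ip f g"
  and ip_cnj: "f \<in> H \<Longrightarrow> g \<in> H \<Longrightarrow> ip g f = cnj (ip f g)"
  and ip_nonneg: "f \<in> H \<Longrightarrow> 0 \<le> Re (ip f f)"
  and ip_zeroD: "f \<in> H \<Longrightarrow> ip f f = 0 \<Longrightarrow> f = (\<lambda>x. 0)"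
  and in_functions_on: "f \<in> H \<Longrightarrow> f \<in> functions_on \<Omega>"
  using hilbert unfolding hilbert_function_space_def by blast+

lemma complete:
  assumes "\<And>n. s n \<in> H"
    and "\<And>e. e > 0 \<Longrightarrow> \<exists>N. \<forall>m\<ge>N. \<forall>n\<ge>N. nrm (\<lambda>x. s m x - s n x) < e"
  shows "\<exists>l\<in>H. (\<lambda>n. nrm (\<lambda>x. s n x - l x)) \<longlonglongrightarrow> 0"
  using hilbert assms unfolding hilbert_function_space_def by blast

lemma diff_in: "f \<in> H \<Longrightarrow> g \<in> H \<Longrightarrow> (\<lambda>x. f x - g x) \<in> H"
  using add_in[of f "\<lambda>x. (-1) * g x"] scale_in[of g "-1"] by simp

lemma ip_diff: "f \<in> H \<Longrightarrow> g \<in> H \<Longrightarrow> h \<in> H \<Longrightarrow> ip (\<lambda>x. f x - g x) h = ip f h - ip g h"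
  using ip_add[of f "\<lambda>x. (-1) * g x" h] scale_in[of g "-1"] ip_scale[of g h "-1"] by simp

lemma ip_add_right:
  "f \<in> H \<Longrightarrow> g \<in> H \<Longrightarrow> h \<in> H \<Longrightarrow> ip h (\<lambda>x. f x + g x) = ip h f + ip h g"
  using ip_add[of f g h] ip_cnj add_in by (metis complex_cnj_add)

lemma ip_diff_right:
  "f \<in> H \<Longrightarrow> g \<in> H \<Longrightarrow> h \<in> H \<Longrightarrow> ip h (\<lambda>x. f x - g x) = ip h f - ip h g"
  using ip_diff[of f g h] ip_cnj diff_in by (metis complex_cnj_diff)

lemma ip_scale_right: "f \<in> H \<Longrightarrow> g \<in> H \<Longrightarrow> ip g (\<lambda>x. c * f x) = cnj c * ip g f"
  using ip_scale[of f g c] ip_cnj scale_in by (metis complex_cnj_mult)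

lemma ip_zero [simp]: "f \<in> H \<Longrightarrow> ip (\<lambda>x. 0) f = 0" "f \<in> H \<Longrightarrow> ip f (\<lambda>x. 0) = 0"
  using ip_scale[of f f 0] ip_scale_right[of f f 0] by auto

lemmas ip_linear = ip_add ip_diff ip_scale ip_add_right ip_diff_right ip_scale_right
  add_in diff_in scale_in

lemma ip_self: "f \<in> H \<Longrightarrow> ip f f = of_real ((nrm f)\<^sup>2)"
  using ip_cnj[of f f] ip_nonneg[of f] by (simp add: hs_norm_def complex_eq_iff)

lemma nrm_nonneg: "f \<in> H \<Longrightarrow> 0 \<le> nrm f"
  by (simp add: hs_norm_def ip_nonneg)

lemma nrm_sq: "f \<in> H \<Longrightarrow> (nrm f)\<^sup>2 = Re (ip f f)"
  by (simp add: ip_self)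

lemma nrm_zeroD: "f \<in> H \<Longrightarrow> nrm f = 0 \<Longrightarrow> f = (\<lambda>x. 0)"
  by (rule ip_zeroD) (simp_all add: ip_self)

lemma nrm_zero [simp]: "nrm (\<lambda>x. 0) = 0"
  by (simp add: hs_norm_def zero_in)

lemma nrm_scale: "f \<in> H \<Longrightarrow> nrm (\<lambda>x. c * f x) = cmod c * nrm f"
proof -
  assume f: "f \<in> H"
  have "(nrm (\<lambda>x. c * f x))\<^sup>2 = (cmod c * nrm f)\<^sup>2"
  proof -
    have "ip (\<lambda>x. c * f x) (\<lambda>x. c * f x) = (c * cnj c) * ip f f"
      using f by (simp add: ip_linear)
    also have "\<dots> = of_real ((cmod c * nrm f)\<^sup>2)"
      using f by (simp add: ip_self complex_mult_cnj cmod_def power_mult_distrib)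
    finally show ?thesis
      using f by (simp add: nrm_sq scale_in)
  qed
  then show ?thesis
    using f by (simp add: nrm_nonneg scale_in)
qed

lemma nrm_minus: "f \<in> H \<Longrightarrow> g \<in> H \<Longrightarrow> nrm (\<lambda>x. f x - g x) = nrm (\<lambda>x. g x - f x)"
  using nrm_scale[of "\<lambda>x. g x - f x" "-1"] by (simp add: diff_in)

lemma nrm_diff_sq:
  "f \<in> H \<Longrightarrow> g \<in> H \<Longrightarrow>
    (nrm (\<lambda>x. f x - g x))\<^sup>2 = (nrm f)\<^sup>2 - 2 * Re (ip f g) + (nrm g)\<^sup>2"
  using ip_cnj[of f g] by (simp add: nrm_sq ip_linear)

text \<open>
  Pythagoras after removing from \<open>f\<close> its component along \<open>g\<close>. Nonnegativity of the left-hand side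
  is Cauchy-Schwarz; comparison with the distance to a subspace gives orthogonality in
  \<open>nearest_point\<close>.
\<close>

lemma nrm_diff_component:
  assumes f: "f \<in> H" and g: "g \<in> H" and "nrm g \<noteq> 0"
  shows "(nrm (\<lambda>x. f x - ip f g / of_real ((nrm g)\<^sup>2) * g x))\<^sup>2
    = (nrm f)\<^sup>2 - (cmod (ip f g))\<^sup>2 / (nrm g)\<^sup>2"
proof -
  define c where "c = ip f g / of_real ((nrm g)\<^sup>2)"
  have "(nrm (\<lambda>x. f x - c * g x))\<^sup>2
      = (nrm f)\<^sup>2 - 2 * Re (ip f (\<lambda>x. c * g x)) + (nrm (\<lambda>x. c * g x))\<^sup>2"
    by (rule nrm_diff_sq) (simp_all add: f g scale_in)
  moreover have "ip f (\<lambda>x. c * g x) = of_real ((cmod (ip f g))\<^sup>2 / (nrm g)\<^sup>2)"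
    using ip_scale_right[OF g f, of c] complex_norm_square[of "ip f g"]
    by (simp add: c_def mult.commute)
  moreover have "(nrm (\<lambda>x. c * g x))\<^sup>2 = (cmod (ip f g))\<^sup>2 / (nrm g)\<^sup>2"
  proof -
    have "nrm (\<lambda>x. c * g x) = cmod (ip f g) / nrm g"
      using nrm_scale[OF g, of c] assms(3)
      by (simp add: c_def norm_divide norm_mult power2_eq_square)
    then show ?thesis by (simp add: power_divide)
  qed
  ultimately show ?thesis by (simp add: c_def)
qed

lemma Cauchy_Schwarz:
  assumes f: "f \<in> H" and g: "g \<in> H"
  shows "cmod (ip f g) \<le> nrm f * nrm g"
proof (cases "nrm g = 0")
  case True
  then have "g = (\<lambda>x. 0)" using g nrm_zeroD by blast
  then show ?thesis using f by simp
next
  case False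
  then have N: "(nrm g)\<^sup>2 > 0" by simp
  have "0 \<le> (nrm f)\<^sup>2 - (cmod (ip f g))\<^sup>2 / (nrm g)\<^sup>2"
    by (subst nrm_diff_component[OF f g False, symmetric]) (rule zero_le_power2)
  then have "(cmod (ip f g))\<^sup>2 / (nrm g)\<^sup>2 \<le> (nrm f)\<^sup>2" by simp
  then have "(cmod (ip f g))\<^sup>2 \<le> (nrm f * nrm g)\<^sup>2"
    using N by (simp add: divide_simps power_mult_distrib)
  then show ?thesis
    by (rule power2_le_imp_le) (use f g nrm_nonneg in auto)
qed

lemma nrm_triangle:
  assumes f: "f \<in> H" and g: "g \<in> H"
  shows "nrm (\<lambda>x. f x + g x) \<le> nrm f + nrm g"
proof (rule power2_le_imp_le)
  have "(nrm (\<lambda>x. f x + g x))\<^sup>2 = (nrm f)\<^sup>2 + 2 * Re (ip f g) + (nrm g)\<^sup>2"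
    using f g ip_cnj[of f g] by (simp add: nrm_sq ip_linear)
  also have "Re (ip f g) \<le> nrm f * nrm g"
    using Cauchy_Schwarz[OF f g] complex_Re_le_cmod order_trans by blast
  finally show "(nrm (\<lambda>x. f x + g x))\<^sup>2 \<le> (nrm f + nrm g)\<^sup>2"
    by (simp add: power2_sum)
qed (use f g nrm_nonneg in auto)

lemma nrm_dist_triangle:
  assumes "f \<in> H" "g \<in> H" "h \<in> H"
  shows "nrm (\<lambda>x. f x - h x) \<le> nrm (\<lambda>x. f x - g x) + nrm (\<lambda>x. g x - h x)"
  using nrm_triangle[of "\<lambda>x. f x - g x" "\<lambda>x. g x - h x"] assms by (simp add: diff_in)

lemma nrm_abs_diff:
  assumes "f \<in> H" "g \<in> H"
  shows "\<bar>nrm f - nrm g\<bar> \<le> nrm (\<lambda>x. f x - g x)"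
  using nrm_triangle[of "\<lambda>x. f x - g x" g] nrm_triangle[of "\<lambda>x. g x - f x" f]
    nrm_minus[of f g] assms by (simp add: diff_in)

lemma tendsto_nrm:
  assumes "\<And>n. s n \<in> H" "p \<in> H" "(\<lambda>n. nrm (\<lambda>x. s n x - p x)) \<longlonglongrightarrow> 0"
  shows "(\<lambda>n. nrm (s n)) \<longlonglongrightarrow> nrm p"
proof -
  have "(\<lambda>n. nrm (s n) - nrm p) \<longlonglongrightarrow> 0"
    by (rule Lim_null_comparison[OF _ assms(3)]) (simp add: nrm_abs_diff assms)
  then show ?thesis by (simp add: LIM_zero_iff)
qed

lemma tendsto_ip:
  assumes "\<And>n. s n \<in> H" "p \<in> H" "h \<in> H" "(\<lambda>n. nrm (\<lambda>x. s n x - p x)) \<longlonglongrightarrow> 0"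
  shows "(\<lambda>n. ip (s n) h) \<longlonglongrightarrow> ip p h"
proof -
  have "(\<lambda>n. ip (s n) h - ip p h) \<longlonglongrightarrow> 0"
  proof (rule Lim_null_comparison)
    show "\<forall>\<^sub>F n in sequentially. norm (ip (s n) h - ip p h) \<le> nrm (\<lambda>x. s n x - p x) * nrm h"
      using Cauchy_Schwarz[OF diff_in[OF assms(1,2)] assms(3)] assms(1-3) by (simp add: ip_diff)
    show "(\<lambda>n. nrm (\<lambda>x. s n x - p x) * nrm h) \<longlonglongrightarrow> 0"
      using tendsto_mult_right[OF assms(4), of "nrm h"] by simp
  qed
  then show ?thesis by (simp add: LIM_zero_iff)
qed

lemma convergent_imp_Cauchy:
  assumes "\<And>n. s n \<in> H" "p \<in> H" "(\<lambda>n. nrm (\<lambda>x. s n x - p x)) \<longlonglongrightarrow> 0" "e > 0"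
  shows "\<exists>N. \<forall>m\<ge>N. \<forall>n\<ge>N. nrm (\<lambda>x. s m x - s n x) < e"
proof -
  obtain N where N: "\<And>n. n \<ge> N \<Longrightarrow> nrm (\<lambda>x. s n x - p x) < e / 2"
    using order_tendstoD(2)[OF assms(3), of "e/2"] assms(4) by (auto simp: eventually_sequentially)
  have "nrm (\<lambda>x. s m x - s n x) < e" if "m \<ge> N" "n \<ge> N" for m n
    using nrm_dist_triangle[OF assms(1)[of m] assms(2) assms(1)[of n]]
      nrm_minus[OF assms(2) assms(1)[of n]] N[OF that(1)] N[OF that(2)] by linarith
  then show ?thesis by blast
qed

text \<open>
  Projection to the closure of \<open>S\<close>. A sequence in \<open>S\<close> that minimizes the distance to \<open>f\<close> is Cauchy
  by the parallelogram law. The subspace need not be closed, and the approximating sequence is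
  returned together with the projection, because later arguments carry this sequence over to
  another space and take its limit there.
\<close>

lemma nearest_point:
  assumes S: "S \<subseteq> H" "(\<lambda>x. 0) \<in> S"
    and S_add: "\<And>s t. s \<in> S \<Longrightarrow> t \<in> S \<Longrightarrow> (\<lambda>x. s x + t x) \<in> S"
    and S_scale: "\<And>c s. s \<in> S \<Longrightarrow> (\<lambda>x. c * s x) \<in> S"
    and f: "f \<in> H"
  obtains p s where "p \<in> H" "\<And>n. s n \<in> S" "(\<lambda>n. nrm (\<lambda>x. s n x - p x)) \<longlonglongrightarrow> 0"
    "\<And>t. t \<in> S \<Longrightarrow> ip (\<lambda>x. f x - p x) t = 0"
proof -
  define D where "D = (\<lambda>s. (nrm (\<lambda>x. f x - s x))\<^sup>2)"
  define d where "d = Inf (D ` S)"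
  have bdd: "bdd_below (D ` S)"
    by (rule bdd_belowI[of _ 0]) (auto simp: D_def)
  have d_le: "d \<le> D s" if "s \<in> S" for s
    unfolding d_def using bdd that by (simp add: cInf_lower)
  have "\<exists>s\<in>S. D s < d + 1 / real (Suc n)" for n
  proof -
    have "d < d + 1 / real (Suc n)" by simp
    then obtain z where "z \<in> D ` S" "z < d + 1 / real (Suc n)"
      unfolding d_def using cInf_lessD[of "D ` S"] S(2) by blast
    then show ?thesis by blast
  qed
  then obtain s where s: "\<And>n. s n \<in> S" and sD: "\<And>n. D (s n) < d + 1 / real (Suc n)"
    by metis
  have sH: "s n \<in> H" for n using s S by blast
  \<comment> \<open>Parallelogram law for \<open>f - s\<^sub>n\<close> and \<open>f - s\<^sub>m\<close>; half their sum is \<open>f\<close> minus the midpoint of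
    \<open>s\<^sub>n\<close> and \<open>s\<^sub>m\<close>, which is in \<open>S\<close>.\<close>
  have par: "(nrm (\<lambda>x. s m x - s n x))\<^sup>2 \<le> 2 / real (Suc m) + 2 / real (Suc n)" for m n
  proof -
    define a b where "a = (\<lambda>x. f x - s n x)" and "b = (\<lambda>x. f x - s m x)"
    define h where "h = (\<lambda>x. (1/2) * (s m x + s n x))"
    have ab: "a \<in> H" "b \<in> H" unfolding a_def b_def using f sH by (auto intro: diff_in)
    have hS: "h \<in> S" unfolding h_def by (intro S_scale S_add s)
    then have hH: "h \<in> H" using S by blast
    have "(\<lambda>x. a x + b x) = (\<lambda>x. 2 * (f x - h x))"
      by (auto simp: a_def b_def h_def field_simps)
    then have "(nrm (\<lambda>x. a x + b x))\<^sup>2 = 4 * D h"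
      using nrm_scale[of "\<lambda>x. f x - h x" 2] f hH by (simp add: diff_in D_def power_mult_distrib)
    then have sum: "(nrm (\<lambda>x. a x + b x))\<^sup>2 \<ge> 4 * d" using d_le[OF hS] by simp
    have "(nrm (\<lambda>x. a x - b x))\<^sup>2 + (nrm (\<lambda>x. a x + b x))\<^sup>2 = 2 * (nrm a)\<^sup>2 + 2 * (nrm b)\<^sup>2"
      using ab ip_cnj[of a b] by (simp add: nrm_sq ip_linear)
    moreover have "(\<lambda>x. a x - b x) = (\<lambda>x. s m x - s n x)" by (auto simp: a_def b_def)
    moreover have "(nrm a)\<^sup>2 < d + 1 / real (Suc n)" "(nrm b)\<^sup>2 < d + 1 / real (Suc m)"
      using sD[of n] sD[of m] by (auto simp: D_def a_def b_def)
    ultimately show ?thesis using sum by simp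
  qed
  have cau: "\<exists>N. \<forall>m\<ge>N. \<forall>n\<ge>N. nrm (\<lambda>x. s m x - s n x) < e" if e: "e > 0" for e
  proof -
    obtain N where N: "1 / real (Suc N) < e\<^sup>2 / 4"
      using nat_approx_posE[of "e\<^sup>2/4"] e by (metis zero_less_divide_iff zero_less_numeral zero_less_power)
    have "nrm (\<lambda>x. s m x - s n x) < e" if mn: "m \<ge> N" "n \<ge> N" for m n
    proof -
      have "1 / real (Suc m) \<le> 1 / real (Suc N)" "1 / real (Suc n) \<le> 1 / real (Suc N)"
        using mn by (auto simp: field_simps)
      then have "(nrm (\<lambda>x. s m x - s n x))\<^sup>2 < e\<^sup>2"
        using par[of m n] N by simp
      then show ?thesis using e by (meson less_imp_le power2_less_imp_less)
    qed
    then show ?thesis by blast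
  qed
  obtain p where p: "p \<in> H" "(\<lambda>n. nrm (\<lambda>x. s n x - p x)) \<longlonglongrightarrow> 0"
    using complete[OF sH cau] by blast
  have orth: "ip (\<lambda>x. f x - p x) t = 0" if t: "t \<in> S" for t
  proof (cases "nrm t = 0")
    case True
    then have "t = (\<lambda>x. 0)" using t S nrm_zeroD by blast
    then show ?thesis using f p by (simp add: diff_in)
  next
    case False
    have tH: "t \<in> H" using t S by blast
    define N where "N = (nrm t)\<^sup>2"
    have N: "N > 0" using False by (simp add: N_def)
    \<comment> \<open>Moving from \<open>s\<^sub>n\<close> along \<open>t\<close> gains at most the remaining gap to the infimum.\<close>
    have bound: "(cmod (ip (\<lambda>x. f x - s n x) t))\<^sup>2 \<le> N * (1 / real (Suc n))" for n
    proof -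
      define r where "r = (\<lambda>x. f x - s n x)"
      have r: "r \<in> H" unfolding r_def using f sH by (auto intro: diff_in)
      define c where "c = ip r t / of_real N"
      have "(\<lambda>x. s n x + c * t x) \<in> S" by (intro S_add S_scale s t)
      then have "d \<le> D (\<lambda>x. s n x + c * t x)" by (rule d_le)
      also have "\<dots> = (nrm (\<lambda>x. r x - c * t x))\<^sup>2"
        by (simp add: D_def r_def algebra_simps)
      also have "\<dots> = (nrm r)\<^sup>2 - (cmod (ip r t))\<^sup>2 / N"
        using nrm_diff_component[OF r tH False] by (simp only: c_def N_def)
      finally have "(cmod (ip r t))\<^sup>2 / N \<le> (nrm r)\<^sup>2 - d" by simp
      also have "\<dots> \<le> 1 / real (Suc n)" using sD[of n] by (simp add: D_def r_def)
      finally have "(cmod (ip r t))\<^sup>2 / N \<le> 1 / real (Suc n)" .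
      then have "(cmod (ip r t))\<^sup>2 \<le> 1 / real (Suc n) * N"
        using N by (subst (asm) pos_divide_le_eq) auto
      then show ?thesis unfolding r_def by (simp add: mult.commute)
    qed
    have lim0: "(\<lambda>n. (cmod (ip (\<lambda>x. f x - s n x) t))\<^sup>2) \<longlonglongrightarrow> 0"
    proof (rule Lim_null_comparison)
      show "\<forall>\<^sub>F n in sequentially.
          norm ((cmod (ip (\<lambda>x. f x - s n x) t))\<^sup>2) \<le> N * (1 / real (Suc n))"
        using bound by simp
      show "(\<lambda>n. N * (1 / real (Suc n))) \<longlonglongrightarrow> 0"
        using tendsto_mult_right_zero[OF LIMSEQ_Suc[OF lim_1_over_n]] by simp
    qed
    have "(\<lambda>n. ip (\<lambda>x. f x - s n x) t) \<longlonglongrightarrow> ip (\<lambda>x. f x - p x) t"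
    proof (rule tendsto_ip)
      have "(\<lambda>x. f x - s n x - (f x - p x)) = (\<lambda>x. p x - s n x)" for n by auto
      then show "(\<lambda>n. nrm (\<lambda>x. f x - s n x - (f x - p x))) \<longlonglongrightarrow> 0"
        using p nrm_minus[OF p(1) sH] by simp
    qed (use f sH p tH in \<open>auto intro: diff_in\<close>)
    then have "(\<lambda>n. (cmod (ip (\<lambda>x. f x - s n x) t))\<^sup>2) \<longlonglongrightarrow> (cmod (ip (\<lambda>x. f x - p x) t))\<^sup>2"
      by (intro tendsto_intros)
    then have "(cmod (ip (\<lambda>x. f x - p x) t))\<^sup>2 = 0"
      using lim0 LIMSEQ_unique by blast
    then show ?thesis by simp
  qed
  show ?thesis by (rule that[OF p(1) s p(2) orth])
qed

text \<open>
  The residual is orthogonal to the projection itself, as this is a limit of elements orthogonal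
  to the residual; so projecting does not increase the norm.
\<close>

lemma nearest_point_norm:
  assumes f: "f \<in> H" and p: "p \<in> H" and s: "\<And>n. s n \<in> H"
    and lim: "(\<lambda>n. nrm (\<lambda>x. s n x - p x)) \<longlonglongrightarrow> 0"
    and orth: "\<And>n. ip (\<lambda>x. f x - p x) (s n) = 0"
  shows "ip (\<lambda>x. f x - p x) p = 0" and "nrm p \<le> nrm f"
proof -
  have r: "(\<lambda>x. f x - p x) \<in> H" using f p by (rule diff_in)
  have "(\<lambda>n. ip (s n) (\<lambda>x. f x - p x)) \<longlonglongrightarrow> ip p (\<lambda>x. f x - p x)"
    by (rule tendsto_ip[OF s p r lim])
  moreover have "ip (s n) (\<lambda>x. f x - p x) = 0" for n
    using ip_cnj[OF r s] orth by simp
  ultimately have 0: "ip p (\<lambda>x. f x - p x) = 0" by (simp add: LIMSEQ_const_iff)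
  then show "ip (\<lambda>x. f x - p x) p = 0" using ip_cnj[OF p r] by simp
  have "ip p f = ip p p" using 0 f p by (simp add: ip_linear)
  then have "(nrm p)\<^sup>2 = cmod (ip p f)" using p by (simp add: ip_self norm_power)
  then have "nrm p * nrm p \<le> nrm p * nrm f"
    using Cauchy_Schwarz[OF p f] by (simp add: power2_eq_square)
  then show "nrm p \<le> nrm f"
    using nrm_nonneg[OF p] nrm_nonneg[OF f] by (cases "nrm p = 0") auto
qed

end

section \<open>Transfer along equal Gram matrices\<close>

text \<open>
  The linear span of the pairs \<open>(a i, b i)\<close>. Building the combinations of \<open>a\<close> and \<open>b\<close> in
  parallel gives the correspondence between the two spans without choosing coefficients, and
  facts about it follow by induction.
\<close>

inductive_set paired_span :: "'i set \<Rightarrow> ('i \<Rightarrow> 'a \<Rightarrow> complex) \<Rightarrow> ('i \<Rightarrow> 'b \<Rightarrow> complex) \<Rightarrow>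
    (('a \<Rightarrow> complex) \<times> ('b \<Rightarrow> complex)) set"
  for I a b where
  zero: "(\<lambda>x. 0, \<lambda>x. 0) \<in> paired_span I a b"
| step: "(p, r) \<in> paired_span I a b \<Longrightarrow> i \<in> I \<Longrightarrow>
    (\<lambda>x. p x + c * a i x, \<lambda>x. r x + c * b i x) \<in> paired_span I a b"

lemma paired_span_scale:
  assumes "(p, r) \<in> paired_span I a b"
  shows "(\<lambda>x. d * p x, \<lambda>x. d * r x) \<in> paired_span I a b"
  using assms
proof induction
  case zero
  then show ?case using paired_span.zero by simp
next
  case (step p r i c)
  then show ?case
    using paired_span.step[OF step.IH step.hyps(2), of "d * c"] by (simp add: algebra_simps)
qed

lemma paired_span_add:
  assumes "(p, r) \<in> paired_span I a b" and "(p', r') \<in> paired_span I a b"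
  shows "(\<lambda>x. p x + p' x, \<lambda>x. r x + r' x) \<in> paired_span I a b"
  using assms(2)
proof induction
  case zero
  then show ?case using assms(1) by simp
next
  case (step p' r' i c)
  then show ?case
    using paired_span.step[OF step.IH step.hyps(2), of c] by (simp add: algebra_simps)
qed

text \<open>
  Equal Gram matrices make \<open>a i \<mapsto> b i\<close> extend to an isometry between the spans. Project \<open>f\<close> to
  the closed span of the \<open>a i\<close> and transport the approximating sequence: it stays Cauchy, and its
  limit has the same inner products with the \<open>b i\<close> as \<open>f\<close> has with the \<open>a i\<close>.
\<close>

lemma gram_transfer:
  assumes "hilbert_fun \<Omega>1 H1 ip1" and "hilbert_fun \<Omega>2 H2 ip2"
    and a: "\<And>i. i \<in> I \<Longrightarrow> a i \<in> H1" and b: "\<And>i. i \<in> I \<Longrightarrow> b i \<in> H2"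
    and gram: "\<And>i j. i \<in> I \<Longrightarrow> j \<in> I \<Longrightarrow> ip1 (a i) (a j) = ip2 (b i) (b j)"
    and f: "f \<in> H1"
  obtains g where "g \<in> H2" "\<And>i. i \<in> I \<Longrightarrow> ip2 g (b i) = ip1 f (a i)" "hs_norm ip2 g \<le> hs_norm ip1 f"
proof -
  interpret A: hilbert_fun \<Omega>1 H1 ip1 by fact
  interpret B: hilbert_fun \<Omega>2 H2 ip2 by fact
  let ?P = "paired_span I a b"
  have mem: "p \<in> H1 \<and> r \<in> H2" if "(p, r) \<in> ?P" for p r
    using that
  proof induction
    case (step p r i c)
    then show ?case
      using A.add_in[OF _ A.scale_in[OF a]] B.add_in[OF _ B.scale_in[OF b]] by simp
  qed (simp add: A.zero_in B.zero_in)
  have gram1: "ip1 p (a j) = ip2 r (b j)" if "(p, r) \<in> ?P" "j \<in> I" for p r j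
    using that
  proof induction
    case (step p r i c)
    then show ?case using mem[OF step.hyps(1)] a b gram
      by (simp add: A.ip_linear B.ip_linear)
  qed (simp add: a b)
  have iso: "ip1 p p' = ip2 r r'" if "(p, r) \<in> ?P" "(p', r') \<in> ?P" for p r p' r'
    using that(2)
  proof induction
    case (step p' r' i c)
    then show ?case using mem[OF step.hyps(1)] mem[OF that(1)] a b gram1[OF that(1)]
      by (simp add: A.ip_linear B.ip_linear)
  qed (use mem[OF that(1)] in simp)
  obtain p s where p: "p \<in> H1" and s: "\<And>n. s n \<in> fst ` ?P"
    and lim: "(\<lambda>n. hs_norm ip1 (\<lambda>x. s n x - p x)) \<longlonglongrightarrow> 0"
    and orth: "\<And>t. t \<in> fst ` ?P \<Longrightarrow> ip1 (\<lambda>x. f x - p x) t = 0"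
  proof (rule A.nearest_point[of "fst ` ?P" f])
    show "fst ` ?P \<subseteq> H1" using mem by auto
    show "(\<lambda>x. 0) \<in> fst ` ?P" by (rule image_eqI[OF _ paired_span.zero]) simp
    show "(\<lambda>x. s x + t x) \<in> fst ` ?P" if st: "s \<in> fst ` ?P" "t \<in> fst ` ?P" for s t
    proof -
      obtain r r' where "(s, r) \<in> ?P" "(t, r') \<in> ?P" using st by auto
      from image_eqI[OF _ paired_span_add[OF this], of "\<lambda>x. s x + t x" fst] show ?thesis by simp
    qed
    show "(\<lambda>x. c * s x) \<in> fst ` ?P" if st: "s \<in> fst ` ?P" for c s
    proof -
      obtain r where "(s, r) \<in> ?P" using st by auto
      from image_eqI[OF _ paired_span_scale[OF this], of "\<lambda>x. c * s x" fst] show ?thesis by simp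
    qed
  qed (use f in auto)
  have "\<forall>n. \<exists>r. (s n, r) \<in> ?P" using s by fastforce
  then obtain t where t: "\<And>n. (s n, t n) \<in> ?P" by metis
  have sH: "s n \<in> H1" and tH: "t n \<in> H2" for n using mem[OF t] by auto
  have "(\<lambda>x. s m x - s n x, \<lambda>x. t m x - t n x) \<in> ?P" for m n
    using paired_span_add[OF t[of m] paired_span_scale[OF t[of n], of "-1"]] by simp
  then have dist: "hs_norm ip1 (\<lambda>x. s m x - s n x) = hs_norm ip2 (\<lambda>x. t m x - t n x)" for m n
    unfolding hs_norm_def using iso[of "\<lambda>x. s m x - s n x" "\<lambda>x. t m x - t n x"] by metis
  have cau: "\<exists>N. \<forall>m\<ge>N. \<forall>n\<ge>N. hs_norm ip2 (\<lambda>x. t m x - t n x) < e" if "e > 0" for e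
    using A.convergent_imp_Cauchy[OF sH p lim that] by (simp only: dist)
  obtain g where g: "g \<in> H2" and limg: "(\<lambda>n. hs_norm ip2 (\<lambda>x. t n x - g x)) \<longlonglongrightarrow> 0"
    using B.complete[OF tH cau] by blast
  show ?thesis
  proof (rule that[OF g])
    fix i assume i: "i \<in> I"
    have "(\<lambda>n. ip1 (s n) (a i)) \<longlonglongrightarrow> ip1 p (a i)"
      by (rule A.tendsto_ip[OF sH p a[OF i] lim])
    moreover have "(\<lambda>n. ip1 (s n) (a i)) \<longlonglongrightarrow> ip2 g (b i)"
      using B.tendsto_ip[OF tH g b[OF i] limg] gram1[OF t i] by simp
    ultimately have "ip2 g (b i) = ip1 p (a i)" using LIMSEQ_unique by blast
    moreover have "a i \<in> fst ` ?P"
      by (rule image_eqI[OF _ paired_span.step[OF paired_span.zero i, of 1]]) simp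
    then have "ip1 f (a i) = ip1 p (a i)"
      using orth[of "a i"] f p a[OF i] by (simp add: A.ip_linear)
    ultimately show "ip2 g (b i) = ip1 f (a i)" by simp
  next
    have "hs_norm ip1 (s n) = hs_norm ip2 (t n)" for n
      using iso[OF t t] by (simp add: hs_norm_def)
    then have "(\<lambda>n. hs_norm ip2 (t n)) \<longlonglongrightarrow> hs_norm ip1 p"
      using A.tendsto_nrm[OF sH p lim] by simp
    then have "hs_norm ip2 g = hs_norm ip1 p"
      using B.tendsto_nrm[OF tH g limg] LIMSEQ_unique by blast
    also have "\<dots> \<le> hs_norm ip1 f"
      by (rule A.nearest_point_norm(2)[OF f p sH lim]) (use orth s in blast)
    finally show "hs_norm ip2 g \<le> hs_norm ip1 f" .
  qed
qed

section \<open>The Hilbert space of square-summable functions\<close>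

definition l2 :: "('x \<Rightarrow> complex) set" where
  "l2 = {f. (\<lambda>x. (cmod (f x))\<^sup>2) summable_on UNIV}"

definition l2_ip :: "('x \<Rightarrow> complex) \<Rightarrow> ('x \<Rightarrow> complex) \<Rightarrow> complex" where
  "l2_ip f g = (\<Sum>\<^sub>\<infinity>x. f x * cnj (g x))"

abbreviation l2_norm :: "('x \<Rightarrow> complex) \<Rightarrow> real" where
  "l2_norm \<equiv> hs_norm l2_ip"

lemma l2_mult_summable:
  assumes "f \<in> l2" "g \<in> l2"
  shows "(\<lambda>x. cmod (f x * g x)) summable_on UNIV"
proof (rule summable_on_comparison_test)
  show "(\<lambda>x. (cmod (f x))\<^sup>2 + (cmod (g x))\<^sup>2) summable_on UNIV"
    using assms by (auto simp: l2_def intro: summable_on_add)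
  show "cmod (f x * g x) \<le> (cmod (f x))\<^sup>2 + (cmod (g x))\<^sup>2" for x
  proof -
    have "2 * (cmod (f x) * cmod (g x)) \<le> (cmod (f x))\<^sup>2 + (cmod (g x))\<^sup>2"
      using sum_squares_bound[of "cmod (f x)" "cmod (g x)"] by simp
    moreover have "0 \<le> cmod (f x) * cmod (g x)" by simp
    ultimately show ?thesis unfolding norm_mult by linarith
  qed
qed simp

lemma l2_cnj: "f \<in> l2 \<Longrightarrow> (\<lambda>x. cnj (f x)) \<in> l2"
  by (simp add: l2_def)

lemma l2_ip_summable:
  assumes "f \<in> l2" "g \<in> l2"
  shows "(\<lambda>x. f x * cnj (g x)) summable_on UNIV"
  by (rule abs_summable_summable[OF l2_mult_summable[OF assms(1) l2_cnj[OF assms(2)]]])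

lemma l2_add:
  assumes "f \<in> l2" "g \<in> l2"
  shows "(\<lambda>x. f x + g x) \<in> l2"
  unfolding l2_def mem_Collect_eq
proof (rule summable_on_comparison_test)
  show "(\<lambda>x. 2 * (cmod (f x))\<^sup>2 + 2 * (cmod (g x))\<^sup>2) summable_on UNIV"
    using assms by (auto simp: l2_def intro: summable_on_add summable_on_cmult_right)
  show "(cmod (f x + g x))\<^sup>2 \<le> 2 * (cmod (f x))\<^sup>2 + 2 * (cmod (g x))\<^sup>2" for x
  proof -
    have "(cmod (f x + g x))\<^sup>2 \<le> (cmod (f x) + cmod (g x))\<^sup>2"
      by (intro power_mono norm_triangle_ineq) simp
    also have "\<dots> \<le> 2 * (cmod (f x))\<^sup>2 + 2 * (cmod (g x))\<^sup>2"
      using sum_squares_bound[of "cmod (f x)" "cmod (g x)"] by (simp add: power2_sum)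
    finally show ?thesis .
  qed
qed simp

lemma l2_scale: "f \<in> l2 \<Longrightarrow> (\<lambda>x. c * f x) \<in> l2"
  by (auto simp: l2_def norm_mult power_mult_distrib intro: summable_on_cmult_right)

lemma l2_ip_self:
  assumes "f \<in> l2"
  shows "l2_ip f f = of_real (\<Sum>\<^sub>\<infinity>x. (cmod (f x))\<^sup>2)"
proof -
  have "((\<lambda>x. (cmod (f x))\<^sup>2) has_sum (\<Sum>\<^sub>\<infinity>x. (cmod (f x))\<^sup>2)) UNIV"
    using assms by (simp add: l2_def)
  then have "((\<lambda>x. of_real ((cmod (f x))\<^sup>2) :: complex) has_sum of_real (\<Sum>\<^sub>\<infinity>x. (cmod (f x))\<^sup>2)) UNIV"
    by (rule has_sum_of_real)
  then show ?thesis
    unfolding l2_ip_def by (intro infsumI) (simp only: complex_norm_square)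
qed

lemma l2_norm_sq:
  assumes "f \<in> l2"
  shows "(l2_norm f)\<^sup>2 = (\<Sum>\<^sub>\<infinity>x. (cmod (f x))\<^sup>2)"
  using l2_ip_self[OF assms] by (simp add: hs_norm_def infsum_nonneg)

lemma l2_norm_nonneg: "f \<in> l2 \<Longrightarrow> 0 \<le> l2_norm f"
  using l2_ip_self[of f] by (simp add: hs_norm_def infsum_nonneg)

lemma l2_finite_sum_le:
  assumes "f \<in> l2" "finite A"
  shows "(\<Sum>x\<in>A. (cmod (f x))\<^sup>2) \<le> (l2_norm f)\<^sup>2"
  unfolding l2_norm_sq[OF assms(1)] using assms
  by (intro finite_sum_le_infsum) (auto simp: l2_def)

lemma l2_coord_le:
  assumes "f \<in> l2"
  shows "cmod (f x) \<le> l2_norm f"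
  using l2_finite_sum_le[OF assms, of "{x}"] l2_norm_nonneg[OF assms]
  by (auto intro: power2_le_imp_le)

text \<open>
  Finite sums determine membership and norm. This is how lower semicontinuity of the norm under
  pointwise limits enters the completeness proof below.
\<close>

lemma l2I:
  assumes "\<And>A. finite A \<Longrightarrow> (\<Sum>x\<in>A. (cmod (f x))\<^sup>2) \<le> B\<^sup>2" and "0 \<le> B"
  shows "f \<in> l2" and "l2_norm f \<le> B"
proof -
  show f: "f \<in> l2"
    unfolding l2_def mem_Collect_eq
    by (rule nonneg_bdd_above_summable_on) (use assms(1) in \<open>auto intro!: bdd_aboveI[of _ "B\<^sup>2"]\<close>)
  have "(l2_norm f)\<^sup>2 \<le> B\<^sup>2"
    unfolding l2_norm_sq[OF f]
    by (rule infsum_le_finite_sums) (use f assms(1) in \<open>auto simp: l2_def\<close>)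
  then show "l2_norm f \<le> B" using assms(2) by (rule power2_le_imp_le)
qed

lemma l2_complete:
  assumes s: "\<And>n. s n \<in> l2"
    and cauchy: "\<And>e. e > 0 \<Longrightarrow> \<exists>N. \<forall>m\<ge>N. \<forall>n\<ge>N. l2_norm (\<lambda>x. s m x - s n x) < e"
  shows "\<exists>l\<in>l2. (\<lambda>n. l2_norm (\<lambda>x. s n x - l x)) \<longlonglongrightarrow> 0"
proof -
  have diff: "(\<lambda>x. f x - g x) \<in> l2" if "f \<in> l2" "g \<in> l2" for f g :: "'a \<Rightarrow> complex"
    using l2_add[OF that(1) l2_scale[OF that(2), of "-1"]] by simp
  have "Cauchy (\<lambda>n. s n x)" for x
  proof (rule metric_CauchyI)
    fix e :: real assume "e > 0"
    then obtain N where N: "\<forall>m\<ge>N. \<forall>n\<ge>N. l2_norm (\<lambda>x. s m x - s n x) < e" using cauchy by blast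
    have "dist (s m x) (s n x) < e" if "m \<ge> N" "n \<ge> N" for m n
      using l2_coord_le[OF diff[OF s[of m] s[of n]], of x] N that by (auto simp: dist_norm intro: le_less_trans)
    then show "\<exists>M. \<forall>m\<ge>M. \<forall>n\<ge>M. dist (s m x) (s n x) < e" by blast
  qed
  then have "\<forall>x. \<exists>y. (\<lambda>n. s n x) \<longlonglongrightarrow> y"
    using Cauchy_convergent_iff convergent_def by blast
  then obtain l where l: "\<And>x. (\<lambda>n. s n x) \<longlonglongrightarrow> l x" by metis
  have near: "\<exists>N. \<forall>n\<ge>N. (\<lambda>x. s n x - l x) \<in> l2 \<and> l2_norm (\<lambda>x. s n x - l x) \<le> e" if e: "e > 0" for e
  proof -
    obtain N where N: "\<And>m n. m \<ge> N \<Longrightarrow> n \<ge> N \<Longrightarrow> l2_norm (\<lambda>x. s n x - s m x) < e"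
      using cauchy[OF e] by blast
    have "(\<Sum>x\<in>A. (cmod (s n x - l x))\<^sup>2) \<le> e\<^sup>2" if n: "n \<ge> N" and A: "finite A" for n A
    proof (rule tendsto_upperbound)
      show "(\<lambda>m. \<Sum>x\<in>A. (cmod (s n x - s m x))\<^sup>2) \<longlonglongrightarrow> (\<Sum>x\<in>A. (cmod (s n x - l x))\<^sup>2)"
        by (intro tendsto_intros l)
      have "(\<Sum>x\<in>A. (cmod (s n x - s m x))\<^sup>2) \<le> e\<^sup>2" if m: "m \<ge> N" for m
      proof -
        have "(\<Sum>x\<in>A. (cmod (s n x - s m x))\<^sup>2) \<le> (l2_norm (\<lambda>x. s n x - s m x))\<^sup>2"
          by (rule l2_finite_sum_le[OF diff[OF s s] A])
        also have "\<dots> \<le> e\<^sup>2"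
          using N[OF m n] l2_norm_nonneg[OF diff[OF s[of n] s[of m]]] by (intro power_mono) auto
        finally show ?thesis .
      qed
      then show "\<forall>\<^sub>F m in sequentially. (\<Sum>x\<in>A. (cmod (s n x - s m x))\<^sup>2) \<le> e\<^sup>2"
        by (auto simp: eventually_sequentially)
    qed simp
    then show ?thesis using l2I e by (metis less_imp_le)
  qed
  obtain M where M: "(\<lambda>x. s M x - l x) \<in> l2" using near[of 1] by auto
  have lin: "l \<in> l2" using diff[OF s[of M] M] by simp
  have "(\<lambda>n. l2_norm (\<lambda>x. s n x - l x)) \<longlonglongrightarrow> 0"
  proof (rule LIMSEQ_I)
    fix r :: real assume "r > 0"
    then obtain N where N: "\<forall>n\<ge>N. l2_norm (\<lambda>x. s n x - l x) \<le> r / 2"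
      using near[of "r/2"] by auto
    have "norm (l2_norm (\<lambda>x. s n x - l x) - 0) < r" if "n \<ge> N" for n
    proof -
      have "l2_norm (\<lambda>x. s n x - l x) \<le> r / 2" using N that by blast
      then show ?thesis using l2_norm_nonneg[OF diff[OF s[of n] lin]] \<open>r > 0\<close> by simp
    qed
    then show "\<exists>N. \<forall>n\<ge>N. norm (l2_norm (\<lambda>x. s n x - l x) - 0) < r" by blast
  qed
  then show ?thesis using lin by blast
qed

interpretation l2: hilbert_fun UNIV l2 l2_ip
proof
  have zero: "(\<lambda>x. 0) \<in> l2" by (simp add: l2_def)
  have add: "l2_ip (\<lambda>x. f x + g x) h = l2_ip f h + l2_ip g h"
    if "f \<in> l2" "g \<in> l2" "h \<in> l2" for f g h :: "'a \<Rightarrow> complex"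
    using infsum_add[OF l2_ip_summable[OF that(1,3)] l2_ip_summable[OF that(2,3)]]
    by (simp add: l2_ip_def distrib_right)
  have scale: "l2_ip (\<lambda>x. c * f x) g = c * l2_ip f g"
    if "f \<in> l2" "g \<in> l2" for c and f g :: "'a \<Rightarrow> complex"
    by (simp add: l2_ip_def mult.assoc infsum_cmult_right')
  have cnj: "l2_ip g f = cnj (l2_ip f g)" for f g :: "'a \<Rightarrow> complex"
    unfolding l2_ip_def by (subst infsum_cnj[symmetric]) (simp add: mult.commute)
  have pos: "0 \<le> Re (l2_ip f f)" if "f \<in> l2" for f :: "'a \<Rightarrow> complex"
    using l2_ip_self[OF that] by (simp add: infsum_nonneg)
  have definite: "f = (\<lambda>x. 0)" if "f \<in> l2" "l2_ip f f = 0" for f :: "'a \<Rightarrow> complex"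
    using l2_coord_le[OF that(1)] that(2) by (auto simp: hs_norm_def)
  show "hilbert_function_space UNIV (l2 :: ('a \<Rightarrow> complex) set) l2_ip"
    unfolding hilbert_function_space_def
  proof (intro conjI ballI allI impI)
    show "(l2 :: ('a \<Rightarrow> complex) set) \<subseteq> functions_on UNIV" by (auto simp: functions_on_def)
    fix s :: "nat \<Rightarrow> 'a \<Rightarrow> complex"
    assume "(\<forall>n. s n \<in> l2) \<and>
      (\<forall>e>0. \<exists>N. \<forall>m\<ge>N. \<forall>n\<ge>N. l2_norm (\<lambda>x. s m x - s n x) < e)"
    then show "\<exists>l\<in>l2. (\<lambda>n. l2_norm (\<lambda>x. s n x - l x)) \<longlonglongrightarrow> 0"
      by (intro l2_complete) auto
  qed (rule zero l2_add l2_scale add scale cnj pos definite; assumption)+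
qed

section \<open>Convolution on the full Fock space\<close>

text \<open>
  The product of power series in non-commuting variables: words are the monomials, and
  concatenation multiplies them. Each coefficient is a finite sum.
\<close>

definition conv :: "('b list \<Rightarrow> complex) \<Rightarrow> ('b list \<Rightarrow> complex) \<Rightarrow> 'b list \<Rightarrow> complex" where
  "conv f g v = (\<Sum>(p, q)\<in>{(p, q). p @ q = v}. f p * g q)"

lemma splits_Cons:
  "{(p, q). p @ q = x # v} = insert ([], x # v) ((\<lambda>(p, q). (x # p, q)) ` {(p, q). p @ q = v})"
  by (auto simp: append_eq_Cons_conv image_iff)

lemma finite_splits: "finite {(p, q). p @ q = v}"
proof (induction v)
  case (Cons x v)
  then show ?case unfolding splits_Cons by simp
qed simp

lemma conv_Nil [simp]: "conv f g [] = f [] * g []"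
proof -
  have "{(p, q). p @ q = []} = {([], [])}" by auto
  then show ?thesis by (simp add: conv_def)
qed

lemma conv_Cons: "conv f g (x # v) = f [] * g (x # v) + conv (\<lambda>w. f (x # w)) g v"
proof -
  have "inj_on (\<lambda>z. (x # fst z, snd z)) A" for A :: "('a list \<times> 'a list) set"
    by (auto simp: inj_on_def prod_eq_iff)
  moreover have "([], x # v) \<notin> (\<lambda>(p, q). (x # p, q)) ` {(p, q). p @ q = v}" by auto
  ultimately show ?thesis
    unfolding conv_def splits_Cons
    by (subst sum.insert) (auto simp: finite_splits sum.reindex case_prod_beta)
qed

text \<open>
  Splitting off the last letter. Read as a statement about the map that removes a last letter
  \<open>x\<close>, this says that it commutes with left convolution by \<open>f\<close> up to a multiple of its image of \<open>f\<close>.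
\<close>

lemma conv_snoc:
  "conv f g (v @ [x]) = f (v @ [x]) * g [] + conv f (\<lambda>w. g (w @ [x])) v"
  by (induction v arbitrary: f) (simp_all add: conv_Cons)

lemma conv_add_left: "conv (\<lambda>w. f w + g w) h = (\<lambda>w. conv f h w + conv g h w)"
  by (simp add: conv_def fun_eq_iff case_prod_beta distrib_right sum.distrib)

lemma conv_add_right: "conv h (\<lambda>w. f w + g w) = (\<lambda>w. conv h f w + conv h g w)"
  by (simp add: conv_def fun_eq_iff case_prod_beta distrib_left sum.distrib)

lemma conv_scale_left: "conv (\<lambda>w. c * f w) h = (\<lambda>w. c * conv f h w)"
  by (simp add: conv_def fun_eq_iff case_prod_beta sum_distrib_left mult.assoc)

lemma conv_scale_right: "conv h (\<lambda>w. c * f w) = (\<lambda>w. c * conv h f w)"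
  by (simp add: conv_def fun_eq_iff case_prod_beta sum_distrib_left mult.left_commute)

lemma conv_diff_left: "conv (\<lambda>w. f w - g w) h = (\<lambda>w. conv f h w - conv g h w)"
  by (simp add: conv_def fun_eq_iff case_prod_beta left_diff_distrib sum_subtractf)

lemma conv_diff_right: "conv h (\<lambda>w. f w - g w) = (\<lambda>w. conv h f w - conv h g w)"
  by (simp add: conv_def fun_eq_iff case_prod_beta right_diff_distrib sum_subtractf)

lemma conv_zero_right [simp]: "conv h (\<lambda>w. 0) = (\<lambda>w. 0)"
  by (simp add: conv_def fun_eq_iff case_prod_beta)

lemmas conv_linear = conv_add_left conv_add_right conv_scale_left conv_scale_right
  conv_diff_left conv_diff_right

lemma conv_assoc: "conv (conv f g) h v = conv f (conv g h) v"
proof (induction v arbitrary: f)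
  case (Cons x v)
  have "conv (\<lambda>w. conv f g (x # w)) h v
      = f [] * conv (\<lambda>w. g (x # w)) h v + conv (conv (\<lambda>w. f (x # w)) g) h v"
    by (simp add: conv_Cons conv_linear)
  then show ?case by (simp add: conv_Cons Cons.IH algebra_simps)
qed simp

definition delta :: "'x \<Rightarrow> 'x \<Rightarrow> complex" where
  "delta w v = (if v = w then 1 else 0)"

text \<open>
  Right multiplication by the letter \<open>x\<close>. These operators are isometries with pairwise orthogonal
  ranges, and removing a last letter \<open>x\<close> is the adjoint.
\<close>

definition rshift :: "'b \<Rightarrow> ('b list \<Rightarrow> complex) \<Rightarrow> 'b list \<Rightarrow> complex" where
  "rshift x g v = (if v \<noteq> [] \<and> last v = x then g (butlast v) else 0)"

lemma rshift_simps [simp]: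
  "rshift x g [] = 0" "rshift x g (v @ [y]) = (if y = x then g v else 0)"
  by (auto simp: rshift_def)

lemma infsum_rshift:
  "(\<Sum>\<^sub>\<infinity>v. F (rshift x g v) v) = (\<Sum>\<^sub>\<infinity>v. F (g v) (v @ [x]))"
  if "\<And>v. F 0 v = 0"
proof -
  have "(\<Sum>\<^sub>\<infinity>v. F (rshift x g v) v) = (\<Sum>\<^sub>\<infinity>v\<in>range (\<lambda>v. v @ [x]). F (rshift x g v) v)"
  proof (rule infsum_cong_neutral)
    fix v assume "v \<in> UNIV - range (\<lambda>v. v @ [x])"
    then show "F (rshift x g v) v = 0" using that by (cases v rule: rev_cases) auto
  qed auto
  also have "\<dots> = (\<Sum>\<^sub>\<infinity>v. F (g v) (v @ [x]))"
    by (subst infsum_reindex) (auto simp: inj_on_def o_def)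
  finally show ?thesis .
qed

lemma rshift_l2: "g \<in> l2 \<Longrightarrow> rshift x g \<in> l2"
proof -
  assume g: "g \<in> l2"
  have "(\<lambda>v. (cmod (rshift x g v))\<^sup>2) summable_on UNIV \<longleftrightarrow>
      (\<lambda>v. (cmod (rshift x g v))\<^sup>2) summable_on range (\<lambda>v. v @ [x])"
  proof (rule summable_on_cong_neutral)
    fix v assume "v \<in> UNIV - range (\<lambda>v. v @ [x])"
    then show "(cmod (rshift x g v))\<^sup>2 = 0" by (cases v rule: rev_cases) auto
  qed auto
  also have "\<dots> \<longleftrightarrow> (\<lambda>v. (cmod (g v))\<^sup>2) summable_on UNIV"
    by (subst summable_on_reindex) (auto simp: inj_on_def o_def)
  finally show ?thesis using g by (simp add: l2_def)
qed

lemma rshift_adjoint: "l2_ip (rshift x g) h = l2_ip g (\<lambda>v. h (v @ [x]))"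
  unfolding l2_ip_def by (rule infsum_rshift) simp

lemma rshift_ip: "l2_ip (rshift x g) (rshift y h) = (if x = y then l2_ip g h else 0)"
  unfolding rshift_adjoint by (simp add: l2_ip_def)

lemma rshift_norm: "l2_norm (rshift x g) = l2_norm g"
  by (simp add: hs_norm_def rshift_ip)

lemma unshift_l2:
  assumes "h \<in> l2"
  shows "(\<lambda>v. h (v @ [x])) \<in> l2" and "l2_norm (\<lambda>v. h (v @ [x])) \<le> l2_norm h"
proof -
  have "(\<Sum>v\<in>A. (cmod (h (v @ [x])))\<^sup>2) \<le> (l2_norm h)\<^sup>2" if "finite A" for A
  proof -
    have "(\<Sum>v\<in>A. (cmod (h (v @ [x])))\<^sup>2) = (\<Sum>v\<in>(\<lambda>v. v @ [x]) ` A. (cmod (h v))\<^sup>2)"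
      by (subst sum.reindex) (auto simp: inj_on_def)
    also have "\<dots> \<le> (l2_norm h)\<^sup>2"
      by (rule l2_finite_sum_le) (use assms that in auto)
    finally show ?thesis .
  qed
  from l2I[OF this l2_norm_nonneg[OF assms]]
  show "(\<lambda>v. h (v @ [x])) \<in> l2" and "l2_norm (\<lambda>v. h (v @ [x])) \<le> l2_norm h" by auto
qed

lemma delta_snoc_unshift: "delta (w @ [x]) (v @ [y]) = (if x = y then delta w v else 0)"
  by (auto simp: delta_def)

lemma conv_delta_Nil: "conv g (delta []) = g"
proof
  fix v show "conv g (delta []) v = g v"
    by (cases v rule: rev_cases) (auto simp: conv_snoc delta_def conv_def[of _ "\<lambda>w. 0"])
qed

lemma conv_delta_snoc: "conv g (delta (w @ [x])) = rshift x (conv g (delta w))"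
proof
  fix v show "conv g (delta (w @ [x])) v = rshift x (conv g (delta w)) v"
  proof (cases v rule: rev_cases)
    case (snoc u y)
    have "(\<lambda>v. delta (w @ [x]) (v @ [y])) = (if x = y then delta w else (\<lambda>v. 0))"
      by (auto simp: delta_snoc_unshift)
    then show ?thesis using snoc by (simp add: conv_snoc) (simp add: delta_def)
  qed (simp add: delta_def)
qed

lemma conv_delta_l2: "g \<in> l2 \<Longrightarrow> conv g (delta w) \<in> l2"
  by (induction w rule: rev_induct) (simp_all add: conv_delta_Nil conv_delta_snoc rshift_l2)

lemma conv_delta_norm: "l2_norm (conv g (delta w)) = l2_norm g"
  by (induction w rule: rev_induct) (simp_all add: conv_delta_Nil conv_delta_snoc rshift_norm)

lemma conv_delta_left_Nil: "conv (delta []) g = g"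
proof
  have "conv (\<lambda>w. 0) g v = 0" for v by (simp add: conv_def)
  then show "conv (delta []) g v = g v" for v
    by (cases v) (auto simp: conv_Cons delta_def)
qed

lemma conv_delta_delta: "conv (delta v) (delta w) = delta (v @ w)"
proof (induction w rule: rev_induct)
  case (snoc x w)
  have "rshift x (delta u) = delta (u @ [x])" for u :: "'a list"
  proof
    fix v show "rshift x (delta u) v = delta (u @ [x]) v"
      by (cases v rule: rev_cases) (auto simp: delta_def)
  qed
  then show ?case using snoc by (simp add: conv_delta_snoc)
qed (simp add: conv_delta_Nil)

text \<open>
  Finitely supported functions, which on words are the non-commutative polynomials. Generating
  them from point masses gives every operator bound and identity below by induction.
\<close>

inductive_set polys :: "('x \<Rightarrow> complex) set" where
  zero: "(\<lambda>v. 0) \<in> polys"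
| step: "p \<in> polys \<Longrightarrow> (\<lambda>v. p v + c * delta w v) \<in> polys"

lemma polys_delta: "delta w \<in> polys"
  using polys.step[OF polys.zero, of 1 w] by simp

lemma polys_add: "q \<in> polys \<Longrightarrow> p \<in> polys \<Longrightarrow> (\<lambda>v. p v + q v) \<in> polys"
proof (induction rule: polys.induct)
  case (step q c w)
  then show ?case using polys.step[of "\<lambda>v. p v + q v" c w] by (simp add: add.assoc)
qed simp

lemma polys_scale: "p \<in> polys \<Longrightarrow> (\<lambda>v. d * p v) \<in> polys"
proof (induction rule: polys.induct)
  case (step p c w)
  then show ?case using polys.step[of "\<lambda>v. d * p v" "d * c" w] by (simp add: algebra_simps)
qed (simp add: polys.zero)

lemma polys_diff: "p \<in> polys \<Longrightarrow> q \<in> polys \<Longrightarrow> (\<lambda>v. p v - q v) \<in> polys"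
  using polys_add[OF polys_scale[of q "-1"], of p] by simp

lemma delta_l2: "delta w \<in> l2"
proof -
  have "(\<lambda>v. (cmod (delta w v))\<^sup>2) summable_on UNIV \<longleftrightarrow> (\<lambda>v. (cmod (delta w v))\<^sup>2) summable_on {w}"
    by (rule summable_on_cong_neutral) (auto simp: delta_def)
  then show ?thesis by (simp add: l2_def)
qed

lemma ip_delta: "l2_ip f (delta w) = f w"
proof -
  have "l2_ip f (delta w) = (\<Sum>\<^sub>\<infinity>v\<in>{w}. f v * cnj (delta w v))"
    unfolding l2_ip_def by (rule infsum_cong_neutral) (auto simp: delta_def)
  then show ?thesis by (simp add: delta_def)
qed

lemma polys_l2: "p \<in> polys \<Longrightarrow> p \<in> l2"
proof (induction rule: polys.induct)
  case (step p c w)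
  show ?case by (rule l2_add[OF step.IH l2_scale[OF delta_l2]])
qed (rule l2.zero_in)

lemma polys_conv:
  assumes "q \<in> polys" "p \<in> polys"
  shows "conv p q \<in> polys"
  using assms
proof (induction rule: polys.induct)
  case (step q c w)
  have "conv p (delta w) \<in> polys" using step.prems
  proof (induction rule: polys.induct)
    case (step p c u)
    then show ?case using polys.step[of "conv p (delta w)" c "u @ w"]
      by (simp add: conv_linear conv_delta_delta)
  qed (simp add: conv_def case_prod_beta polys.zero)
  then have "(\<lambda>v. conv p q v + c * conv p (delta w) v) \<in> polys"
    using step by (intro polys_add polys_scale) auto
  then show ?case by (simp add: conv_linear)
qed (simp add: polys.zero)

text \<open>
  Stability under the adjoint shifts, the property that makes the orthogonality argument of
  \<open>wandering_vector_generates\<close> recursive in the word.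
\<close>

lemma polys_unshift: "p \<in> polys \<Longrightarrow> (\<lambda>v. p (v @ [x])) \<in> polys"
proof (induction rule: polys.induct)
  case (step p c w)
  have "(\<lambda>v. delta w (v @ [x])) \<in> polys"
  proof (cases w rule: rev_cases)
    case (snoc u y)
    then show ?thesis by (cases "x = y") (auto simp: delta_snoc_unshift polys_delta polys.zero)
  qed (simp add: delta_def polys.zero)
  then show ?case using step by (intro polys_add polys_scale) auto
qed (simp add: polys.zero)

text \<open>
  Right convolution by a general element of \<open>l\<^sup>2\<close> is not bounded; by a point mass it is isometric, and a
  polynomial is a finite combination of these.
\<close>

lemma conv_poly_bounded:
  assumes "p \<in> polys"
  shows "\<exists>K\<ge>0. \<forall>g\<in>l2. conv g p \<in> l2 \<and> l2_norm (conv g p) \<le> K * l2_norm g"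
  using assms
proof (induction rule: polys.induct)
  case zero
  then show ?case by (auto simp: l2.zero_in intro!: exI[of _ 0])
next
  case (step p c w)
  then obtain K where K: "K \<ge> 0" "\<And>g. g \<in> l2 \<Longrightarrow> conv g p \<in> l2"
    "\<And>g. g \<in> l2 \<Longrightarrow> l2_norm (conv g p) \<le> K * l2_norm g" by blast
  have "conv g (\<lambda>v. p v + c * delta w v) \<in> l2 \<and>
      l2_norm (conv g (\<lambda>v. p v + c * delta w v)) \<le> (K + cmod c) * l2_norm g" if g: "g \<in> l2" for g
  proof -
    have 1: "(\<lambda>v. c * conv g (delta w) v) \<in> l2" using g by (simp add: l2_scale conv_delta_l2)
    have "l2_norm (\<lambda>v. conv g p v + c * conv g (delta w) v)
        \<le> l2_norm (conv g p) + l2_norm (\<lambda>v. c * conv g (delta w) v)"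
      by (rule l2.nrm_triangle[OF K(2)[OF g] 1])
    also have "l2_norm (\<lambda>v. c * conv g (delta w) v) = cmod c * l2_norm g"
      using g by (simp add: l2.nrm_scale conv_delta_l2 conv_delta_norm)
    also have "l2_norm (conv g p) \<le> K * l2_norm g" by (rule K(3)[OF g])
    finally have "l2_norm (\<lambda>v. conv g p v + c * conv g (delta w) v) \<le> (K + cmod c) * l2_norm g"
      by (simp add: algebra_simps)
    then show ?thesis using l2_add[OF K(2)[OF g] 1] by (simp add: conv_linear)
  qed
  then show ?case using K(1) by (intro exI[of _ "K + cmod c"]) auto
qed

lemma conv_poly_l2: "p \<in> polys \<Longrightarrow> g \<in> l2 \<Longrightarrow> conv g p \<in> l2"
  using conv_poly_bounded by blast

lemma polys_restrict: "finite A \<Longrightarrow> (\<lambda>v. if v \<in> A then g v else 0) \<in> polys"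
proof (induction A rule: finite_induct)
  case (insert w A)
  have "(\<lambda>v. (if v \<in> A then g v else 0) + g w * delta w v) = (\<lambda>v. if v \<in> insert w A then g v else 0)"
    using insert by (auto simp: delta_def)
  then show ?case using polys.step[OF insert.IH, of "g w" w] by simp
qed (simp add: polys.zero)

lemma polys_dense:
  assumes g: "g \<in> l2" and e: "e > 0"
  obtains p where "p \<in> polys" "l2_norm (\<lambda>v. g v - p v) < e"
proof -
  have s: "(\<lambda>v. (cmod (g v))\<^sup>2) summable_on UNIV" using g by (simp add: l2_def)
  obtain A where A: "finite A"
    and dist: "dist (\<Sum>v\<in>A. (cmod (g v))\<^sup>2) (\<Sum>\<^sub>\<infinity>v. (cmod (g v))\<^sup>2) \<le> (e / 2)\<^sup>2"
    using infsum_finite_approximation[OF s, of "(e/2)\<^sup>2"] e by auto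
  define p where "p = (\<lambda>v. if v \<in> A then g v else 0)"
  have p: "p \<in> polys" unfolding p_def by (rule polys_restrict[OF A])
  have gp: "(\<lambda>v. g v - p v) \<in> l2" using g polys_l2[OF p] by (rule l2.diff_in)
  have "(l2_norm (\<lambda>v. g v - p v))\<^sup>2 = (\<Sum>\<^sub>\<infinity>v\<in>UNIV - A. (cmod (g v))\<^sup>2)"
    unfolding l2_norm_sq[OF gp] by (rule infsum_cong_neutral) (auto simp: p_def)
  also have "\<dots> = (\<Sum>\<^sub>\<infinity>v. (cmod (g v))\<^sup>2) - (\<Sum>v\<in>A. (cmod (g v))\<^sup>2)"
    using infsum_Diff[OF s, of A] A by simp
  also have "\<dots> \<le> (e / 2)\<^sup>2" using dist by (simp add: dist_real_def)
  finally have "l2_norm (\<lambda>v. g v - p v) \<le> e / 2"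
    by (rule power2_le_imp_le) (use e in simp)
  then show ?thesis using that[OF p] e by simp
qed

section \<open>Inner-outer factorization on the full Fock space\<close>

text \<open>
  The closure of the right multiples of \<open>f\<close> by polynomials. For \<open>f\<close> in \<open>l\<^sup>2\<close> it is the smallest closed subspace
  containing \<open>f\<close> and invariant under all right shifts.
\<close>

definition cyclic_subspace :: "('b list \<Rightarrow> complex) \<Rightarrow> ('b list \<Rightarrow> complex) set" where
  "cyclic_subspace f = {g \<in> l2. \<forall>e>0. \<exists>b\<in>polys. l2_norm (\<lambda>v. g v - conv f b v) < e}"

lemma cyclic_subspace_l2: "g \<in> cyclic_subspace f \<Longrightarrow> g \<in> l2"
  by (simp add: cyclic_subspace_def)

lemma cyclic_subspaceD: "g \<in> cyclic_subspace f \<Longrightarrow> e > 0 \<Longrightarrow> \<exists>b\<in>polys. l2_norm (\<lambda>v. g v - conv f b v) < e"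
  by (simp add: cyclic_subspace_def)

lemma cyclic_subspace_conv:
  assumes f: "f \<in> l2" and g: "g \<in> cyclic_subspace f" and c: "c \<in> polys"
  shows "conv g c \<in> cyclic_subspace f"
  unfolding cyclic_subspace_def
proof (intro CollectI conjI allI impI)
  obtain K where K: "K \<ge> 0" "\<And>g. g \<in> l2 \<Longrightarrow> l2_norm (conv g c) \<le> K * l2_norm g"
    using conv_poly_bounded[OF c] by blast
  show "conv g c \<in> l2" by (rule conv_poly_l2[OF c cyclic_subspace_l2[OF g]])
  fix e :: real assume e: "e > 0"
  obtain b where b: "b \<in> polys" "l2_norm (\<lambda>v. g v - conv f b v) < e / (K + 1)"
    using cyclic_subspaceD[OF g, of "e / (K + 1)"] e K(1) by auto
  have in_l2: "(\<lambda>v. g v - conv f b v) \<in> l2"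
    by (rule l2.diff_in[OF cyclic_subspace_l2[OF g] conv_poly_l2[OF b(1) f]])
  have "(\<lambda>v. conv g c v - conv f (conv b c) v) = conv (\<lambda>v. g v - conv f b v) c"
    by (simp add: conv_linear conv_assoc)
  then have "l2_norm (\<lambda>v. conv g c v - conv f (conv b c) v) \<le> K * l2_norm (\<lambda>v. g v - conv f b v)"
    using K(2)[OF in_l2] by simp
  also have "\<dots> \<le> K * (e / (K + 1))" by (rule mult_left_mono) (use b K in auto)
  also have "\<dots> < e" using e K(1) by (simp add: field_simps)
  finally show "\<exists>b\<in>polys. l2_norm (\<lambda>v. conv g c v - conv f b v) < e"
    using polys_conv[OF c b(1)] by blast
qed

lemma cyclic_subspace_self: "f \<in> l2 \<Longrightarrow> f \<in> cyclic_subspace f"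
  unfolding cyclic_subspace_def by (auto intro!: bexI[OF _ polys_delta[of "[]"]] simp: conv_delta_Nil)

lemma cyclic_subspace_closed:
  assumes f: "f \<in> l2" and s: "\<And>n. s n \<in> cyclic_subspace f" and p: "p \<in> l2"
    and lim: "(\<lambda>n. l2_norm (\<lambda>v. s n v - p v)) \<longlonglongrightarrow> 0"
  shows "p \<in> cyclic_subspace f"
  unfolding cyclic_subspace_def
proof (intro CollectI conjI allI impI p)
  fix e :: real assume e: "e > 0"
  obtain n where n: "l2_norm (\<lambda>v. s n v - p v) < e / 2"
    using order_tendstoD(2)[OF lim, of "e/2"] e by (auto simp: eventually_sequentially)
  obtain b where b: "b \<in> polys" "l2_norm (\<lambda>v. s n v - conv f b v) < e / 2"
    using cyclic_subspaceD[OF s[of n], of "e/2"] e by auto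
  have "l2_norm (\<lambda>v. p v - conv f b v)
      \<le> l2_norm (\<lambda>v. p v - s n v) + l2_norm (\<lambda>v. s n v - conv f b v)"
    by (rule l2.nrm_dist_triangle[OF p cyclic_subspace_l2[OF s] conv_poly_l2[OF b(1) f]])
  also have "l2_norm (\<lambda>v. p v - s n v) = l2_norm (\<lambda>v. s n v - p v)"
    by (rule l2.nrm_minus[OF p cyclic_subspace_l2[OF s]])
  finally show "\<exists>b\<in>polys. l2_norm (\<lambda>v. p v - conv f b v) < e" using n b by force
qed

lemma cyclic_subspace_diff:
  assumes f: "f \<in> l2" and g: "g \<in> cyclic_subspace f" and h: "h \<in> cyclic_subspace f"
  shows "(\<lambda>v. g v - h v) \<in> cyclic_subspace f"
  unfolding cyclic_subspace_def
proof (intro CollectI conjI allI impI)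
  show "(\<lambda>v. g v - h v) \<in> l2" by (rule l2.diff_in[OF cyclic_subspace_l2[OF g] cyclic_subspace_l2[OF h]])
  fix e :: real assume e: "e > 0"
  obtain b where b: "b \<in> polys" "l2_norm (\<lambda>v. g v - conv f b v) < e / 2"
    using cyclic_subspaceD[OF g, of "e/2"] e by auto
  obtain c where c: "c \<in> polys" "l2_norm (\<lambda>v. h v - conv f c v) < e / 2"
    using cyclic_subspaceD[OF h, of "e/2"] e by auto
  have gb: "(\<lambda>v. g v - conv f b v) \<in> l2"
    by (rule l2.diff_in[OF cyclic_subspace_l2[OF g] conv_poly_l2[OF b(1) f]])
  have ch: "(\<lambda>v. conv f c v - h v) \<in> l2"
    by (rule l2.diff_in[OF conv_poly_l2[OF c(1) f] cyclic_subspace_l2[OF h]])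
  have "(\<lambda>v. g v - h v - conv f (\<lambda>w. b w - c w) v)
      = (\<lambda>v. (g v - conv f b v) + (conv f c v - h v))"
    by (simp add: conv_linear fun_eq_iff)
  then have "l2_norm (\<lambda>v. g v - h v - conv f (\<lambda>w. b w - c w) v)
      \<le> l2_norm (\<lambda>v. g v - conv f b v) + l2_norm (\<lambda>v. conv f c v - h v)"
    using l2.nrm_triangle[OF gb ch] by simp
  also have "l2_norm (\<lambda>v. conv f c v - h v) = l2_norm (\<lambda>v. h v - conv f c v)"
    by (rule l2.nrm_minus[OF conv_poly_l2[OF c(1) f] cyclic_subspace_l2[OF h]])
  finally show "\<exists>b\<in>polys. l2_norm (\<lambda>v. g v - h v - conv f b v) < e"
    using b c polys_diff[OF b(1) c(1)] by force
qed

text \<open>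
  The lowest degree of \<open>f\<close> cannot be reached by right multiples of \<open>f\<close> without constant term.
\<close>

lemma conv_vanishes:
  assumes "\<And>w. length w < length v \<Longrightarrow> f w = 0" and "c [] = 0"
  shows "conv f c v = 0"
  using assms(1)
proof (induction v arbitrary: f)
  case (Cons x v)
  have "f [] = 0" by (rule Cons.prems) simp
  moreover have "conv (\<lambda>w. f (x # w)) c v = 0" by (rule Cons.IH) (simp add: Cons.prems)
  ultimately show ?case by (simp add: conv_Cons)
qed (simp add: assms(2))

text \<open>
  Projection to the closure of the multiples of \<open>f\<close> by a space \<open>B\<close> of polynomials, with the
  approximating sequence given by its polynomial factors. It serves twice: with the polynomials
  without constant term to find the wandering vector, and with all polynomials to divide by it.
\<close>

lemma nearest_multiple:
  assumes f: "f \<in> l2" and g: "g \<in> l2"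
    and B: "B \<subseteq> polys" "(\<lambda>v. 0) \<in> B"
      "\<And>b c. b \<in> B \<Longrightarrow> c \<in> B \<Longrightarrow> (\<lambda>v. b v + c v) \<in> B"
      "\<And>d b. b \<in> B \<Longrightarrow> (\<lambda>v. d * b v) \<in> B"
  obtains p b where "p \<in> l2" "\<And>n. b n \<in> B"
    "(\<lambda>n. l2_norm (\<lambda>v. conv f (b n) v - p v)) \<longlonglongrightarrow> 0"
    "\<And>c. c \<in> B \<Longrightarrow> l2_ip (\<lambda>v. g v - p v) (conv f c) = 0"
proof -
  obtain p s where p: "p \<in> l2" and s: "\<And>n. s n \<in> conv f ` B"
    and lim: "(\<lambda>n. l2_norm (\<lambda>x. s n x - p x)) \<longlonglongrightarrow> 0"
    and orth: "\<And>t. t \<in> conv f ` B \<Longrightarrow> l2_ip (\<lambda>x. g x - p x) t = 0"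
  proof (rule l2.nearest_point[of "conv f ` B" g])
    show "conv f ` B \<subseteq> l2" using conv_poly_l2 f B(1) by blast
    show "(\<lambda>x. 0) \<in> conv f ` B" by (rule image_eqI[OF _ B(2)]) simp
    show "(\<lambda>x. s x + t x) \<in> conv f ` B" if st: "s \<in> conv f ` B" "t \<in> conv f ` B" for s t
    proof -
      obtain b c where "s = conv f b" "t = conv f c" "b \<in> B" "c \<in> B" using st by blast
      then show ?thesis by (intro image_eqI[OF _ B(3)[of b c]]) (simp_all add: conv_linear)
    qed
    show "(\<lambda>x. d * s x) \<in> conv f ` B" if st: "s \<in> conv f ` B" for d s
    proof -
      obtain b where "s = conv f b" "b \<in> B" using st by blast
      then show ?thesis by (intro image_eqI[OF _ B(4)[of b d]]) (simp_all add: conv_linear)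
    qed
  qed (use g in auto)
  have "\<forall>n. \<exists>b\<in>B. s n = conv f b" using s by blast
  then obtain b where b: "\<And>n. b n \<in> B" and sb: "\<And>n. s n = conv f (b n)" by metis
  show ?thesis
    by (rule that[OF p b]) (use lim orth in \<open>auto simp: sb\<close>)
qed

text \<open>
  The part of \<open>f\<close> orthogonal to the proper right multiples of \<open>f\<close>, normalized. It does not
  vanish: at a word of minimal length in the support of \<open>f\<close>, all proper multiples of \<open>f\<close> are zero
  by \<open>conv_vanishes\<close>, and so is their limit \<open>p\<close>.
\<close>

lemma wandering_vector:
  assumes f: "f \<in> l2" and nz: "f \<noteq> (\<lambda>v. 0)"
  obtains \<theta> where "\<theta> \<in> cyclic_subspace f" "l2_norm \<theta> = 1" "l2_ip f \<theta> \<noteq> 0"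
    "\<And>c. c \<in> polys \<Longrightarrow> c [] = 0 \<Longrightarrow> l2_ip (conv f c) \<theta> = 0"
proof -
  define B :: "('a list \<Rightarrow> complex) set" where "B = {c \<in> polys. c [] = 0}"
  obtain p b where p: "p \<in> l2" and b: "\<And>n. b n \<in> B"
    and lim: "(\<lambda>n. l2_norm (\<lambda>v. conv f (b n) v - p v)) \<longlonglongrightarrow> 0"
    and orth: "\<And>c. c \<in> B \<Longrightarrow> l2_ip (\<lambda>v. f v - p v) (conv f c) = 0"
    by (rule nearest_multiple[OF f f, of B]) (auto simp: B_def polys.zero polys_add polys_scale)
  have b_poly: "b n \<in> polys" and b0: "b n [] = 0" for n using b by (auto simp: B_def)
  have s_l2: "conv f (b n) \<in> l2" for n by (rule conv_poly_l2[OF b_poly f])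
  define q where "q = (\<lambda>x. f x - p x)"
  have q: "q \<in> l2" unfolding q_def by (rule l2.diff_in[OF f p])
  have "p \<in> cyclic_subspace f"
    by (rule cyclic_subspace_closed[OF f cyclic_subspace_conv[OF f cyclic_subspace_self[OF f] b_poly] p lim])
  then have q_cyc: "q \<in> cyclic_subspace f" unfolding q_def by (rule cyclic_subspace_diff[OF f cyclic_subspace_self[OF f]])
  have "q \<noteq> (\<lambda>v. 0)"
  proof -
    obtain v where v: "f v \<noteq> 0" and min: "\<And>w. length w < length v \<Longrightarrow> f w = 0"
      using nz exE_some[of "\<lambda>v. f v \<noteq> 0"] arg_min_natI[of "\<lambda>v. f v \<noteq> 0" _ length]
        arg_min_nat_le[of "\<lambda>v. f v \<noteq> 0" _ length] by (metis leD)
    have s0: "conv f (b n) v = 0" for n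
      using conv_vanishes[of v f "b n"] min b0 by blast
    have "(\<lambda>n. cmod (p v)) \<longlonglongrightarrow> 0"
    proof (rule Lim_null_comparison[OF _ lim])
      have "cmod (p v) \<le> l2_norm (\<lambda>v. conv f (b n) v - p v)" for n
        using l2_coord_le[OF l2.diff_in[OF s_l2[of n] p], of v] s0[of n] by simp
      then show "\<forall>\<^sub>F n in sequentially. norm (cmod (p v)) \<le> l2_norm (\<lambda>v. conv f (b n) v - p v)"
        by simp
    qed
    then have "p v = 0" by (simp add: LIMSEQ_const_iff)
    then have "q v \<noteq> 0" using v by (simp add: q_def)
    then show ?thesis by auto
  qed
  then have N: "l2_norm q > 0"
    using l2.nrm_zeroD[OF q] l2.nrm_nonneg[OF q] by fastforce
  define c where "c = complex_of_real (1 / l2_norm q)"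
  have c0: "c \<noteq> 0" using N by (simp add: c_def)
  define \<theta> where "\<theta> = (\<lambda>v. c * q v)"
  show ?thesis
  proof (rule that)
    have "conv q (\<lambda>v. c * delta [] v) \<in> cyclic_subspace f"
      by (rule cyclic_subspace_conv[OF f q_cyc polys_scale[OF polys_delta]])
    then show "\<theta> \<in> cyclic_subspace f" by (simp add: conv_linear conv_delta_Nil \<theta>_def)
    show "l2_norm \<theta> = 1" unfolding \<theta>_def l2.nrm_scale[OF q] using N by (simp add: c_def norm_divide)
    have "l2_ip q p = 0"
      unfolding q_def
      by (rule l2.nearest_point_norm(1)[OF f p s_l2 lim]) (rule orth[OF b])
    then have "l2_ip p q = 0" using l2.ip_cnj[OF q p] by simp
    moreover have "l2_ip q q = l2_ip f q - l2_ip p q"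
      using l2.ip_diff[OF f p q] by (simp add: q_def)
    ultimately have "l2_ip f q = of_real ((l2_norm q)\<^sup>2)" using l2.ip_self[OF q] by simp
    then have "l2_ip f q \<noteq> 0" using N by simp
    then show "l2_ip f \<theta> \<noteq> 0"
      unfolding \<theta>_def l2.ip_scale_right[OF q f] using c0 by simp
    fix d :: "'a list \<Rightarrow> complex" assume d: "d \<in> polys" "d [] = 0"
    have "l2_ip q (conv f d) = 0" unfolding q_def by (rule orth) (use d in \<open>simp add: B_def\<close>)
    then have "l2_ip (conv f d) q = 0" using l2.ip_cnj[OF q conv_poly_l2[OF d(1) f]] by simp
    then show "l2_ip (conv f d) \<theta> = 0"
      unfolding \<theta>_def l2.ip_scale_right[OF q conv_poly_l2[OF d(1) f]] by simp
  qed
qed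

text \<open>
  The orthogonality condition involves only proper translates of \<open>\<theta>\<close> against \<open>\<theta>\<close> itself. Since the
  letter shifts are isometries with orthogonal ranges, it already forces all right translates
  to be orthonormal.
\<close>

definition inner_function :: "('b list \<Rightarrow> complex) \<Rightarrow> bool" where
  "inner_function \<theta> \<longleftrightarrow> \<theta> \<in> l2 \<and> l2_norm \<theta> = 1 \<and> (\<forall>w. w \<noteq> [] \<longrightarrow> l2_ip (conv \<theta> (delta w)) \<theta> = 0)"

text \<open>
  A common last letter of the two words can be cancelled, and different last letters give
  orthogonal vectors; this reduces to the case where one word is empty.
\<close>

lemma inner_function_orthonormal:
  assumes "inner_function \<theta>"
  shows "l2_ip (conv \<theta> (delta v)) (conv \<theta> (delta w)) = (if v = w then 1 else 0)"
proof (induction v arbitrary: w rule: rev_induct)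
  case Nil
  have th: "\<theta> \<in> l2" "l2_norm \<theta> = 1" using assms by (auto simp: inner_function_def)
  show ?case
  proof (cases "w = []")
    case True
    then show ?thesis using l2.ip_self[OF th(1)] th(2) by (simp add: conv_delta_Nil)
  next
    case False
    then have "l2_ip (conv \<theta> (delta w)) \<theta> = 0" using assms by (simp add: inner_function_def)
    then show ?thesis
      using False l2.ip_cnj[OF conv_delta_l2[OF th(1), of w] th(1)] by (simp add: conv_delta_Nil)
  qed
next
  case (snoc x v)
  note IH = snoc.IH
  show ?case
  proof (cases w rule: rev_cases)
    case Nil
    then show ?thesis using assms by (auto simp: inner_function_def conv_delta_Nil)
  next
    case (snoc u y)
    then show ?thesis unfolding snoc conv_delta_snoc rshift_ip IH by auto
  qed
qed

lemma inner_function_ip_polys: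
  assumes th: "inner_function \<theta>" and b: "b \<in> polys" and c: "c \<in> polys"
  shows "l2_ip (conv \<theta> b) (conv \<theta> c) = l2_ip b c"
proof -
  have t: "\<theta> \<in> l2" using th by (simp add: inner_function_def)
  have 1: "l2_ip (conv \<theta> b) (conv \<theta> (delta w)) = b w" for w
    using b
  proof (induction rule: polys.induct)
    case zero
    then show ?case using conv_delta_l2[OF t] by simp
  next
    case (step p c u)
    have "l2_ip (conv \<theta> (\<lambda>v. p v + c * delta u v)) (conv \<theta> (delta w))
        = l2_ip (conv \<theta> p) (conv \<theta> (delta w)) + c * l2_ip (conv \<theta> (delta u)) (conv \<theta> (delta w))"
      unfolding conv_linear
      using l2.ip_add[OF conv_poly_l2[OF step.hyps t] l2_scale[OF conv_delta_l2[OF t]]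
          conv_delta_l2[OF t, of w]]
        l2.ip_scale[OF conv_delta_l2[OF t, of u] conv_delta_l2[OF t, of w]] by simp
    moreover have "delta u w = (if u = w then 1 else 0)" by (simp add: delta_def)
    ultimately show ?case using step.IH inner_function_orthonormal[OF th, of u w] by simp
  qed
  show ?thesis
    using c
  proof (induction rule: polys.induct)
    case zero
    then show ?case using conv_poly_l2[OF b t] polys_l2[OF b] by simp
  next
    case (step p c u)
    have "l2_ip (conv \<theta> b) (conv \<theta> (\<lambda>v. p v + c * delta u v))
        = l2_ip (conv \<theta> b) (conv \<theta> p) + cnj c * l2_ip (conv \<theta> b) (conv \<theta> (delta u))"
      unfolding conv_linear
      using l2.ip_add_right[OF conv_poly_l2[OF step.hyps t] l2_scale[OF conv_delta_l2[OF t]]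
          conv_poly_l2[OF b t]]
        l2.ip_scale_right[OF conv_delta_l2[OF t, of u] conv_poly_l2[OF b t]] by simp
    also have "\<dots> = l2_ip b p + cnj c * l2_ip b (delta u)"
      by (simp add: step.IH 1 ip_delta)
    also have "\<dots> = l2_ip b (\<lambda>v. p v + c * delta u v)"
      using l2.ip_add_right[OF polys_l2[OF step.hyps] l2_scale[OF delta_l2] polys_l2[OF b]]
        l2.ip_scale_right[OF delta_l2 polys_l2[OF b]] by simp
    finally show ?case .
  qed
qed

lemma inner_function_norm_polys:
  "inner_function \<theta> \<Longrightarrow> b \<in> polys \<Longrightarrow> l2_norm (conv \<theta> b) = l2_norm b"
  by (simp add: hs_norm_def inner_function_ip_polys)

lemma l2_tendsto_coord:
  assumes s: "\<And>n. s n \<in> l2" and p: "p \<in> l2" and lim: "(\<lambda>n. l2_norm (\<lambda>x. s n x - p x)) \<longlonglongrightarrow> 0"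
  shows "(\<lambda>n. s n x) \<longlonglongrightarrow> p x"
proof (rule LIM_zero_cancel, rule Lim_null_comparison[OF _ lim])
  show "\<forall>\<^sub>F n in sequentially. norm (s n x - p x) \<le> l2_norm (\<lambda>x. s n x - p x)"
    using l2_coord_le[OF l2.diff_in[OF s p], of _ x] by simp
qed

lemma conv_tendsto:
  assumes "\<And>n. s n \<in> l2" "p \<in> l2" "(\<lambda>n. l2_norm (\<lambda>x. s n x - p x)) \<longlonglongrightarrow> 0"
  shows "(\<lambda>n. conv \<theta> (s n) v) \<longlonglongrightarrow> conv \<theta> p v"
  unfolding conv_def case_prod_beta by (intro tendsto_intros l2_tendsto_coord[OF assms])

text \<open>
  The isometry on polynomials extends to limits. The limit in norm agrees with the convolution
  because both are pointwise limits of the same sequence.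
\<close>

lemma inner_function_limit:
  assumes th: "inner_function \<theta>" and b: "\<And>n. b n \<in> polys" and G: "G \<in> l2"
    and lim: "(\<lambda>n. l2_norm (\<lambda>x. b n x - G x)) \<longlonglongrightarrow> 0"
  shows "conv \<theta> G \<in> l2" and "l2_norm (conv \<theta> G) = l2_norm G"
    and "(\<lambda>n. l2_norm (\<lambda>x. conv \<theta> (b n) x - conv \<theta> G x)) \<longlonglongrightarrow> 0"
proof -
  have t: "\<theta> \<in> l2" using th by (simp add: inner_function_def)
  have b_l2: "b n \<in> l2" and tb: "conv \<theta> (b n) \<in> l2" for n
    using polys_l2[OF b] conv_poly_l2[OF b t] by auto
  have iso: "l2_norm (\<lambda>x. conv \<theta> (b m) x - conv \<theta> (b n) x) = l2_norm (\<lambda>x. b m x - b n x)" for m n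
    using inner_function_norm_polys[OF th polys_diff[OF b[of m] b[of n]]] by (simp add: conv_linear)
  have cau: "\<exists>N. \<forall>m\<ge>N. \<forall>n\<ge>N. l2_norm (\<lambda>x. conv \<theta> (b m) x - conv \<theta> (b n) x) < e" if "e > 0" for e
    unfolding iso by (rule l2.convergent_imp_Cauchy[OF b_l2 G lim that])
  then obtain L where L: "L \<in> l2" and limL: "(\<lambda>n. l2_norm (\<lambda>x. conv \<theta> (b n) x - L x)) \<longlonglongrightarrow> 0"
    using l2.complete[OF tb cau] by blast
  have L_eq: "L = conv \<theta> G"
  proof
    fix v
    show "L v = conv \<theta> G v"
      by (rule LIMSEQ_unique[OF l2_tendsto_coord[OF tb L limL] conv_tendsto[OF b_l2 G lim]])
  qed
  show "conv \<theta> G \<in> l2" using L L_eq by simp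
  show "(\<lambda>n. l2_norm (\<lambda>x. conv \<theta> (b n) x - conv \<theta> G x)) \<longlonglongrightarrow> 0" using limL L_eq by simp
  have "(\<lambda>n. l2_norm (b n)) \<longlonglongrightarrow> l2_norm L"
    using l2.tendsto_nrm[OF tb L limL] by (simp add: inner_function_norm_polys[OF th b])
  then show "l2_norm (conv \<theta> G) = l2_norm G"
    using l2.tendsto_nrm[OF b_l2 G lim] L_eq LIMSEQ_unique by blast
qed

lemma polys_sequence:
  assumes G: "G \<in> l2"
  obtains b where "\<And>n. b n \<in> polys" "(\<lambda>n. l2_norm (\<lambda>x. b n x - G x)) \<longlonglongrightarrow> 0"
proof -
  have "\<exists>p. p \<in> polys \<and> l2_norm (\<lambda>v. G v - p v) < 1 / real (Suc n)" for n
    using polys_dense[OF G, of "1 / real (Suc n)"] by auto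
  then obtain b where b: "\<And>n. b n \<in> polys" "\<And>n. l2_norm (\<lambda>v. G v - b n v) < 1 / real (Suc n)"
    by metis
  have "(\<lambda>n. l2_norm (\<lambda>x. b n x - G x)) \<longlonglongrightarrow> 0"
  proof (rule Lim_null_comparison[OF _ LIMSEQ_Suc[OF lim_1_over_n]])
    have "norm (l2_norm (\<lambda>x. b n x - G x)) \<le> 1 / real (Suc n)" for n
      using b(2)[of n] l2.nrm_minus[OF G polys_l2[OF b(1)[of n]]]
        l2.nrm_nonneg[OF l2.diff_in[OF polys_l2[OF b(1)[of n]] G]] by simp
    then show "\<forall>\<^sub>F n in sequentially. norm (l2_norm (\<lambda>x. b n x - G x)) \<le> 1 / of_nat (Suc n)"
      by simp
  qed
  then show ?thesis using that b(1) by blast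
qed

lemma inner_function_isometry:
  assumes "inner_function \<theta>" "G \<in> l2"
  shows "conv \<theta> G \<in> l2" and "l2_norm (conv \<theta> G) = l2_norm G"
proof -
  obtain b where "\<And>n. b n \<in> polys" "(\<lambda>n. l2_norm (\<lambda>x. b n x - G x)) \<longlonglongrightarrow> 0"
    using polys_sequence[OF assms(2)] by blast
  from inner_function_limit(1,2)[OF assms(1) this(1) assms(2) this(2)]
  show "conv \<theta> G \<in> l2" and "l2_norm (conv \<theta> G) = l2_norm G" by auto
qed

text \<open>
  A proper right translate of \<open>\<theta>\<close> is a limit of proper right multiples of \<open>f\<close>, and those are
  orthogonal to \<open>\<theta>\<close>.
\<close>

lemma wandering_vector_inner:
  assumes f: "f \<in> l2" and th: "\<theta> \<in> cyclic_subspace f" "l2_norm \<theta> = 1"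
    and orth: "\<And>c. c \<in> polys \<Longrightarrow> c [] = 0 \<Longrightarrow> l2_ip (conv f c) \<theta> = 0"
  shows "inner_function \<theta>"
  unfolding inner_function_def
proof (intro conjI allI impI th cyclic_subspace_l2[OF th(1)])
  fix w :: "'a list" assume w: "w \<noteq> []"
  have t: "\<theta> \<in> l2" by (rule cyclic_subspace_l2[OF th(1)])
  have "cmod (l2_ip (conv \<theta> (delta w)) \<theta>) \<le> 0 + e" if e: "e > 0" for e
  proof -
    obtain b where b: "b \<in> polys" "l2_norm (\<lambda>v. \<theta> v - conv f b v) < e"
      using cyclic_subspaceD[OF th(1) e] by blast
    define r where "r = (\<lambda>v. \<theta> v - conv f b v)"
    have r: "r \<in> l2" unfolding r_def by (rule l2.diff_in[OF t conv_poly_l2[OF b(1) f]])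
    have bw: "conv b (delta w) \<in> polys" by (rule polys_conv[OF polys_delta b(1)])
    have "conv r (delta w) = (\<lambda>v. conv \<theta> (delta w) v - conv f (conv b (delta w)) v)"
      by (simp add: r_def conv_linear conv_assoc)
    then have "l2_ip (conv r (delta w)) \<theta>
        = l2_ip (conv \<theta> (delta w)) \<theta> - l2_ip (conv f (conv b (delta w))) \<theta>"
      using l2.ip_diff[OF conv_delta_l2[OF t, of w] conv_poly_l2[OF bw f] t] by simp
    also have "l2_ip (conv f (conv b (delta w))) \<theta> = 0"
      by (rule orth[OF bw]) (use w in \<open>simp add: delta_def\<close>)
    finally have "cmod (l2_ip (conv \<theta> (delta w)) \<theta>) = cmod (l2_ip (conv r (delta w)) \<theta>)" by simp
    also have "\<dots> \<le> l2_norm (conv r (delta w)) * l2_norm \<theta>"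
      by (rule l2.Cauchy_Schwarz[OF conv_delta_l2[OF r] t])
    also have "\<dots> < e" using b(2) th(2) by (simp add: conv_delta_norm r_def)
    finally show ?thesis by simp
  qed
  then have "cmod (l2_ip (conv \<theta> (delta w)) \<theta>) \<le> 0" by (rule field_le_epsilon)
  then show "l2_ip (conv \<theta> (delta w)) \<theta> = 0" by simp
qed

text \<open>
  The translates of \<open>\<theta>\<close> span the cyclic subspace of \<open>f\<close>. The set of all \<open>h\<close> in this subspace that
  are orthogonal to them is stable under the adjoint shifts, and its elements vanish at \<open>[]\<close>; by
  removing the letters of \<open>v\<close> from the right, such an \<open>h\<close> vanishes at \<open>v\<close>. Both properties come
  from one estimate: in an approximation of \<open>h\<close> by \<open>conv f b\<close>, the constant term of \<open>b\<close> is
  detected by the inner product with \<open>\<theta>\<close>, and so it is small because \<open>h\<close> is orthogonal to \<open>\<theta>\<close>.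
\<close>

lemma wandering_vector_generates:
  assumes f: "f \<in> l2" and th: "\<theta> \<in> l2" "l2_norm \<theta> = 1" and f\<theta>: "l2_ip f \<theta> \<noteq> 0"
    and orth: "\<And>c. c \<in> polys \<Longrightarrow> c [] = 0 \<Longrightarrow> l2_ip (conv f c) \<theta> = 0"
    and h: "h \<in> cyclic_subspace f" and h_orth: "\<And>c. c \<in> polys \<Longrightarrow> l2_ip h (conv \<theta> c) = 0"
  shows "h v = 0"
  using h h_orth
proof (induction v arbitrary: h rule: rev_induct)
  define \<kappa> where "\<kappa> = cmod (l2_ip f \<theta>)"
  have \<kappa>: "\<kappa> > 0" using f\<theta> by (simp add: \<kappa>_def)
  have approx: "\<exists>b\<in>polys. l2_norm (\<lambda>v. h v - conv f b v) < e \<and> cmod (b []) < e"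
    if h: "h \<in> cyclic_subspace f" "\<And>c. c \<in> polys \<Longrightarrow> l2_ip h (conv \<theta> c) = 0" and e: "e > 0" for h e
  proof -
    obtain b where b: "b \<in> polys" "l2_norm (\<lambda>v. h v - conv f b v) < min e (e * \<kappa>)"
      using cyclic_subspaceD[OF h(1), of "min e (e * \<kappa>)"] e \<kappa> by auto
    have hl: "h \<in> l2" by (rule cyclic_subspace_l2[OF h(1)])
    \<comment> \<open>Pairing \<open>conv f b\<close> with \<open>\<theta>\<close> sees only the constant term of \<open>b\<close>.\<close>
    define c where "c = (\<lambda>w. b w - b [] * delta [] w)"
    have c: "c \<in> polys" unfolding c_def by (intro polys_diff polys_scale polys_delta b)
    have c0: "c [] = 0" by (simp add: c_def delta_def)
    have "conv f b = (\<lambda>v. conv f c v + b [] * f v)"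
      by (simp add: c_def conv_linear conv_delta_Nil)
    then have "l2_ip (conv f b) \<theta> = l2_ip (conv f c) \<theta> + b [] * l2_ip f \<theta>"
      using l2.ip_add[OF conv_poly_l2[OF c f] l2_scale[OF f] th(1)] l2.ip_scale[OF f th(1)] by simp
    also have "l2_ip (conv f c) \<theta> = 0" by (rule orth[OF c c0])
    finally have 1: "l2_ip (conv f b) \<theta> = b [] * l2_ip f \<theta>" by simp
    have "l2_ip h \<theta> = 0" using h(2)[OF polys_delta[of "[]"]] by (simp add: conv_delta_Nil)
    then have "l2_ip (\<lambda>v. h v - conv f b v) \<theta> = - (b [] * l2_ip f \<theta>)"
      using l2.ip_diff[OF hl conv_poly_l2[OF b(1) f] th(1)] 1 by simp
    then have "cmod (b []) * \<kappa> = cmod (l2_ip (\<lambda>v. h v - conv f b v) \<theta>)"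
      by (simp add: \<kappa>_def norm_mult)
    also have "\<dots> \<le> l2_norm (\<lambda>v. h v - conv f b v) * l2_norm \<theta>"
      by (rule l2.Cauchy_Schwarz[OF l2.diff_in[OF hl conv_poly_l2[OF b(1) f]] th(1)])
    also have "\<dots> < e * \<kappa>" using b(2) th(2) by simp
    finally have "cmod (b []) < e" using \<kappa> by simp
    then show ?thesis using b by auto
  qed
  {
    case Nil
    have hl: "h \<in> l2" by (rule cyclic_subspace_l2[OF Nil(1)])
    have "cmod (h []) \<le> 0 + e" if e: "e > 0" for e
    proof -
      define d where "d = e / (1 + cmod (f []))"
      have fp: "1 + cmod (f []) > 0" by (simp add: add_pos_nonneg)
      have d: "d > 0" using e fp by (simp add: d_def)
      obtain b where b: "b \<in> polys" "l2_norm (\<lambda>v. h v - conv f b v) < d" "cmod (b []) < d"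
        using approx[OF Nil d] by blast
      have "cmod (h [] - f [] * b []) \<le> l2_norm (\<lambda>v. h v - conv f b v)"
        using l2_coord_le[OF l2.diff_in[OF hl conv_poly_l2[OF b(1) f]], of "[]"] by simp
      moreover have "cmod (h []) \<le> cmod (h [] - f [] * b []) + cmod (f [] * b [])"
        by (metis diff_add_cancel norm_triangle_ineq)
      moreover have "cmod (f [] * b []) \<le> cmod (f []) * d"
        unfolding norm_mult by (rule mult_left_mono) (use b in auto)
      ultimately have "cmod (h []) \<le> d * (1 + cmod (f []))"
        using b(2) by (simp add: algebra_simps)
      also have "\<dots> = e" using fp by (simp add: d_def)
      finally show ?thesis by simp
    qed
    then have "cmod (h []) \<le> 0" by (rule field_le_epsilon)
    then show ?case by simp
  next
    case (snoc x v)
    have hl: "h \<in> l2" by (rule cyclic_subspace_l2[OF snoc.prems(1)])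
    define g where "g = (\<lambda>w. h (w @ [x]))"
    have g: "g \<in> l2" unfolding g_def by (rule unshift_l2[OF hl])
    \<comment> \<open>Removing the last letter from \<open>conv f b\<close> leaves \<open>conv f c\<close> with \<open>c\<close> the shifted \<open>b\<close>, up to
      \<open>b []\<close> times a vector of norm at most \<open>l2_norm f\<close>.\<close>
    have g_cyc: "g \<in> cyclic_subspace f"
      unfolding cyclic_subspace_def
    proof (intro CollectI conjI allI impI g)
      fix e :: real assume e: "e > 0"
      define d where "d = e / (1 + l2_norm f)"
      have fp: "1 + l2_norm f > 0" using l2.nrm_nonneg[OF f] by simp
      have d: "d > 0" using e fp by (simp add: d_def)
      obtain b where b: "b \<in> polys" "l2_norm (\<lambda>v. h v - conv f b v) < d" "cmod (b []) < d"
        using approx[OF snoc.prems d] by blast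
      define c where "c = (\<lambda>w. b (w @ [x]))"
      have c: "c \<in> polys" unfolding c_def by (rule polys_unshift[OF b(1)])
      define fx where "fx = (\<lambda>w. f (w @ [x]))"
      have fx: "fx \<in> l2" "l2_norm fx \<le> l2_norm f" unfolding fx_def by (rule unshift_l2[OF f])+
      define r where "r = (\<lambda>v. h v - conv f b v)"
      have r: "r \<in> l2" unfolding r_def by (rule l2.diff_in[OF hl conv_poly_l2[OF b(1) f]])
      have "(\<lambda>w. g w - conv f c w) = (\<lambda>w. r (w @ [x]) + b [] * fx w)"
        by (simp add: g_def c_def r_def fx_def conv_snoc)
      then have "l2_norm (\<lambda>w. g w - conv f c w)
          \<le> l2_norm (\<lambda>w. r (w @ [x])) + l2_norm (\<lambda>w. b [] * fx w)"
        using l2.nrm_triangle[OF unshift_l2(1)[OF r] l2_scale[OF fx(1)]] by simp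
      also have "l2_norm (\<lambda>w. r (w @ [x])) \<le> l2_norm r" by (rule unshift_l2[OF r])
      also have "l2_norm r < d" using b(2) by (simp add: r_def)
      also have "l2_norm (\<lambda>w. b [] * fx w) = cmod (b []) * l2_norm fx"
        by (rule l2.nrm_scale[OF fx(1)])
      also have "\<dots> \<le> d * l2_norm f"
        by (rule mult_mono) (use b fx l2.nrm_nonneg[OF fx(1)] d in auto)
      finally have "l2_norm (\<lambda>w. g w - conv f c w) < d * (1 + l2_norm f)"
        by (simp add: algebra_simps)
      also have "\<dots> = e" using fp by (simp add: d_def)
      finally show "\<exists>b\<in>polys. l2_norm (\<lambda>w. g w - conv f b w) < e" using c by blast
    qed
    have "l2_ip g (conv \<theta> c) = 0" if c: "c \<in> polys" for c
    proof -
      have cx: "conv c (delta [x]) \<in> polys" by (rule polys_conv[OF polys_delta c])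
      have tc: "conv \<theta> c \<in> l2" by (rule conv_poly_l2[OF c th(1)])
      have "rshift x (conv \<theta> c) = conv \<theta> (conv c (delta [x]))"
        using conv_delta_snoc[of "conv \<theta> c" "[]" x] by (simp add: conv_delta_Nil conv_assoc fun_eq_iff)
      then have "l2_ip h (rshift x (conv \<theta> c)) = 0" using snoc.prems(2)[OF cx] by simp
      then have "l2_ip (rshift x (conv \<theta> c)) h = 0"
        using l2.ip_cnj[OF hl rshift_l2[OF tc, of x]] by simp
      then have "l2_ip (conv \<theta> c) g = 0" by (simp add: rshift_adjoint g_def)
      then show ?thesis using l2.ip_cnj[OF tc g] by simp
    qed
    then have "g v = 0" by (rule snoc.IH[OF g_cyc])
    then show ?case by (simp add: g_def)
  }
qed

text \<open>
  Dividing by \<open>\<theta>\<close> in the limit: \<open>f\<close> is a limit of \<open>conv \<theta> (b n)\<close>, and the isometry makes the \<open>b n\<close>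
  a Cauchy sequence, whose limit is \<open>F\<close>. Outerness of \<open>F\<close> is the membership of \<open>\<theta>\<close> in the cyclic
  subspace of \<open>f\<close> pulled back by the same isometry. Only the constant \<open>delta []\<close> has to be reached, as the
  cyclic subspace is then everything.
\<close>

theorem inner_outer_factorization:
  assumes f: "f \<in> l2" and nz: "f \<noteq> (\<lambda>v. 0)"
  obtains \<theta> F where "inner_function \<theta>" "F \<in> l2" "conv \<theta> F = f" "delta [] \<in> cyclic_subspace F"
proof -
  obtain \<theta> where th: "\<theta> \<in> cyclic_subspace f" "l2_norm \<theta> = 1" "l2_ip f \<theta> \<noteq> 0"
    and orth: "\<And>c. c \<in> polys \<Longrightarrow> c [] = 0 \<Longrightarrow> l2_ip (conv f c) \<theta> = 0"
    using wandering_vector[OF f nz] by blast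
  have inn: "inner_function \<theta>" by (rule wandering_vector_inner[OF f th(1,2) orth])
  have t: "\<theta> \<in> l2" by (rule cyclic_subspace_l2[OF th(1)])
  obtain p b where p: "p \<in> l2" and b: "\<And>n. b n \<in> polys"
    and lim: "(\<lambda>n. l2_norm (\<lambda>v. conv \<theta> (b n) v - p v)) \<longlonglongrightarrow> 0"
    and p_orth: "\<And>c. c \<in> polys \<Longrightarrow> l2_ip (\<lambda>v. f v - p v) (conv \<theta> c) = 0"
    by (rule nearest_multiple[OF t f, of polys]) (auto simp: polys.zero polys_add polys_scale)
  have s_l2: "conv \<theta> (b n) \<in> l2" for n by (rule conv_poly_l2[OF b t])
  have "p \<in> cyclic_subspace f" by (rule cyclic_subspace_closed[OF f cyclic_subspace_conv[OF f th(1) b] p lim])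
  then have "(\<lambda>v. f v - p v) \<in> cyclic_subspace f" by (rule cyclic_subspace_diff[OF f cyclic_subspace_self[OF f]])
  then have "f v - p v = 0" for v
    using wandering_vector_generates[OF f t th(2,3) orth, where h="\<lambda>v. f v - p v" and v=v] p_orth
    by simp
  \<comment> \<open>The residual of the projection is orthogonal to all translates of \<open>\<theta>\<close>.\<close>
  then have pf: "p = f" by (auto simp: fun_eq_iff)
  have iso: "l2_norm (\<lambda>x. b m x - b n x) 
      = l2_norm (\<lambda>x. conv \<theta> (b m) x - conv \<theta> (b n) x)" for m n
    using inner_function_norm_polys[OF inn polys_diff[OF b[of m] b[of n]]] by (simp add: conv_linear)
  have cau: "\<exists>N. \<forall>m\<ge>N. \<forall>n\<ge>N. l2_norm (\<lambda>x. b m x - b n x) < e" if "e > 0" for e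
    unfolding iso by (rule l2.convergent_imp_Cauchy[OF s_l2 p lim that])
  then obtain F where F: "F \<in> l2" and limF: "(\<lambda>n. l2_norm (\<lambda>x. b n x - F x)) \<longlonglongrightarrow> 0"
    using l2.complete[OF polys_l2[OF b] cau] by blast
  have fac: "conv \<theta> F = f"
  proof
    fix v
    have "(\<lambda>n. conv \<theta> (b n) v) \<longlonglongrightarrow> conv \<theta> F v"
      by (rule conv_tendsto[OF polys_l2[OF b] F limF])
    then show "conv \<theta> F v = f v"
      using l2_tendsto_coord[OF s_l2 p lim] LIMSEQ_unique by (auto simp: pf)
  qed
  have "delta [] \<in> cyclic_subspace F"
    unfolding cyclic_subspace_def
  proof (intro CollectI conjI allI impI delta_l2)
    fix e :: real assume "e > 0"
    then obtain c where c: "c \<in> polys" "l2_norm (\<lambda>v. \<theta> v - conv f c v) < e"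
      using cyclic_subspaceD[OF th(1)] by blast
    have "conv \<theta> (\<lambda>v. delta [] v - conv F c v) = (\<lambda>v. \<theta> v - conv f c v)"
      by (simp add: conv_diff_right conv_delta_Nil conv_assoc[symmetric] fac)
    then have "l2_norm (\<lambda>v. delta [] v - conv F c v) < e"
      using inner_function_isometry(2)[OF inn l2.diff_in[OF delta_l2[of "[]"] conv_poly_l2[OF c(1) F]]] c(2) by simp
    then show "\<exists>b\<in>polys. l2_norm (\<lambda>v. delta [] v - conv F b v) < e" using c by blast
  qed
  then show ?thesis using that inn F fac by blast
qed

section \<open>Power series in non-commuting variables evaluated at a point\<close>

lemma lists_decompose: "(UNIV :: 'b list set) = insert [] ((\<lambda>(x, w). x # w) ` (UNIV \<times> UNIV))"
proof -
  have "v \<in> insert [] ((\<lambda>(x, w). x # w) ` (UNIV \<times> UNIV))" for v :: "'b list"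
    by (cases v) auto
  then show ?thesis by blast
qed

lemma summable_on_lists_iff:
  fixes h :: "'b list \<Rightarrow> 'c::banach"
  shows "h summable_on UNIV \<longleftrightarrow> (\<lambda>(x, w). h (x # w)) summable_on UNIV \<times> UNIV"
proof -
  have "h summable_on UNIV \<longleftrightarrow> h summable_on (\<lambda>(x, w). x # w) ` (UNIV \<times> UNIV)"
  proof
    assume "h summable_on (\<lambda>(x, w). x # w) ` (UNIV \<times> UNIV)"
    then have "(h has_sum (h [] + infsum h ((\<lambda>(x, w). x # w) ` (UNIV \<times> UNIV))))
        (insert [] ((\<lambda>(x, w). x # w) ` (UNIV \<times> UNIV)))"
      by (intro has_sum_insert) auto
    then show "h summable_on UNIV"
      unfolding lists_decompose[symmetric] by (rule has_sum_imp_summable)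
  qed (rule summable_on_subset_banach, auto)
  also have "\<dots> \<longleftrightarrow> (\<lambda>(x, w). h (x # w)) summable_on UNIV \<times> UNIV"
    by (subst summable_on_reindex) (auto simp: inj_on_def o_def case_prod_unfold)
  finally show ?thesis .
qed

lemma infsum_lists:
  fixes h :: "'b list \<Rightarrow> 'c::banach"
  assumes "h summable_on UNIV"
  shows "infsum h UNIV = h [] + (\<Sum>\<^sub>\<infinity>x. \<Sum>\<^sub>\<infinity>w. h (x # w))"
proof -
  have s: "(\<lambda>(x, w). h (x # w)) summable_on UNIV \<times> UNIV"
    using assms by (simp only: summable_on_lists_iff[of h])
  have "infsum h UNIV = infsum h (insert [] ((\<lambda>(x, w). x # w) ` (UNIV \<times> UNIV)))"
    by (subst lists_decompose) (rule refl)
  also have "\<dots> = h [] + infsum h ((\<lambda>(x, w). x # w) ` (UNIV \<times> UNIV))"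
    by (rule infsum_insert) (auto intro: summable_on_subset_banach[OF assms])
  also have "infsum h ((\<lambda>(x, w). x # w) ` (UNIV \<times> UNIV)) = (\<Sum>\<^sub>\<infinity>(x, w)\<in>UNIV \<times> UNIV. h (x # w))"
    by (subst infsum_reindex) (auto simp: inj_on_def o_def case_prod_unfold)
  also have "\<dots> = (\<Sum>\<^sub>\<infinity>x. \<Sum>\<^sub>\<infinity>w. h (x # w))"
    by (rule infsum_Sigma'_banach[OF s, symmetric])
  finally show ?thesis .
qed

text \<open>
  The value at the point \<open>z\<close> of the monomial given by a word.
\<close>

definition monom_at :: "('b \<Rightarrow> complex) \<Rightarrow> 'b list \<Rightarrow> complex" where
  "monom_at z w = prod_list (map z w)"

lemma monom_at_simps [simp]:
  "monom_at z [] = 1" "monom_at z (x # w) = z x * monom_at z w"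
  "monom_at z (v @ w) = monom_at z v * monom_at z w"
  by (simp_all add: monom_at_def)

lemma monom_at_mult: "monom_at (\<lambda>n. y n * z n) w = monom_at y w * monom_at z w"
  by (induction w) (simp_all add: mult_ac)

lemma monom_at_cnj: "monom_at (\<lambda>n. cnj (z n)) w = cnj (monom_at z w)"
  by (induction w) simp_all

text \<open>
  Splitting words into head and tail turns a bound \<open>C\<close> for shorter words into \<open>1 + s * C\<close>, where
  \<open>s\<close> is the sum over the letters; \<open>C = 1 / (1 - s)\<close> is the fixed point.
\<close>

lemma words_geometric_bound:
  assumes z: "(\<lambda>n. cmod (z n)) summable_on UNIV" and s: "(\<Sum>\<^sub>\<infinity>n. cmod (z n)) < 1"
    and "finite A" "A \<subseteq> {w. length w < N}"
  shows "(\<Sum>w\<in>A. cmod (monom_at z w)) \<le> 1 / (1 - (\<Sum>\<^sub>\<infinity>n. cmod (z n)))"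
  using assms(3,4)
proof (induction N arbitrary: A)
  case 0
  then show ?case using s by simp
next
  case (Suc N)
  define s where "s = (\<Sum>\<^sub>\<infinity>n. cmod (z n))"
  have s1: "s < 1" and s0: "0 \<le> s" using assms(2) by (auto simp: s_def intro: infsum_nonneg)
  define hs ts where "hs = hd ` (A - {[]})" and "ts = tl ` (A - {[]})"
  have fin: "finite hs" "finite ts" using Suc.prems by (auto simp: hs_def ts_def)
  have ts: "ts \<subseteq> {w. length w < N}"
  proof
    fix w assume "w \<in> ts"
    then obtain v where "v \<in> A" "v \<noteq> []" "w = tl v" by (auto simp: ts_def)
    then show "w \<in> {w. length w < N}" using Suc.prems(2) by (cases v) auto
  qed
  have sub: "A \<subseteq> insert [] ((\<lambda>(x, w). x # w) ` (hs \<times> ts))"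
  proof
    fix v assume v: "v \<in> A"
    show "v \<in> insert [] ((\<lambda>(x, w). x # w) ` (hs \<times> ts))"
    proof (cases v)
      case (Cons x w)
      then have "x \<in> hs" "w \<in> ts" using v by (force simp: hs_def ts_def)+
      then show ?thesis using Cons by auto
    qed simp
  qed
  have "(\<Sum>w\<in>A. cmod (monom_at z w))
      \<le> (\<Sum>w\<in>insert [] ((\<lambda>(x, w). x # w) ` (hs \<times> ts)). cmod (monom_at z w))"
    by (rule sum_mono2) (use fin sub in auto)
  also have "\<dots> = 1 + (\<Sum>w\<in>(\<lambda>(x, w). x # w) ` (hs \<times> ts). cmod (monom_at z w))"
    by (subst sum.insert) (use fin in auto)
  also have "(\<Sum>w\<in>(\<lambda>(x, w). x # w) ` (hs \<times> ts). cmod (monom_at z w))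
      = (\<Sum>(x, w)\<in>hs \<times> ts. cmod (z x) * cmod (monom_at z w))"
    by (subst sum.reindex) (auto simp: inj_on_def case_prod_beta norm_mult)
  also have "\<dots> = (\<Sum>x\<in>hs. cmod (z x)) * (\<Sum>w\<in>ts. cmod (monom_at z w))"
    by (simp add: sum_product sum.cartesian_product)
  also have "\<dots> \<le> s * (1 / (1 - s))"
  proof (rule mult_mono)
    show "(\<Sum>x\<in>hs. cmod (z x)) \<le> s"
      unfolding s_def by (rule finite_sum_le_infsum) (use z fin in auto)
    show "(\<Sum>w\<in>ts. cmod (monom_at z w)) \<le> 1 / (1 - s)"
      unfolding s_def by (rule Suc.IH[OF fin(2)]) (rule ts)
  qed (use s0 in \<open>auto intro: sum_nonneg\<close>)
  also have "1 + s * (1 / (1 - s)) = 1 / (1 - s)" using s1 by (simp add: field_simps)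
  finally show ?case by (simp add: s_def)
qed

text \<open>
  The geometric series, organized over words instead of powers: once convergence is known, the
  sum satisfies \<open>T = 1 + s * T\<close>.
\<close>

lemma words_geometric_series:
  assumes z: "(\<lambda>n. cmod (z n)) summable_on UNIV" and s: "(\<Sum>\<^sub>\<infinity>n. cmod (z n)) < 1"
  shows "(\<lambda>w. cmod (monom_at z w)) summable_on UNIV"
    and "(\<Sum>\<^sub>\<infinity>w. monom_at z w) = 1 / (1 - (\<Sum>\<^sub>\<infinity>n. z n))"
proof -
  show abs: "(\<lambda>w. cmod (monom_at z w)) summable_on UNIV"
  proof (rule nonneg_bdd_above_summable_on)
    have "(\<Sum>w\<in>A. cmod (monom_at z w)) \<le> 1 / (1 - (\<Sum>\<^sub>\<infinity>n. cmod (z n)))" if "finite A" for A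
      by (rule words_geometric_bound[OF z s that, of "Suc (Max (length ` A))"])
        (use that in \<open>auto simp: less_Suc_eq_le\<close>)
    then show "bdd_above (sum (\<lambda>w. cmod (monom_at z w)) ` {F. F \<subseteq> UNIV \<and> finite F})"
      by (intro bdd_aboveI2) auto
  qed simp
  have sm: "monom_at z summable_on UNIV" by (rule abs_summable_summable[OF abs])
  define T where "T = infsum (monom_at z) UNIV"
  have "T = 1 + (\<Sum>\<^sub>\<infinity>n. z n) * T"
    using infsum_lists[OF sm] by (simp add: T_def infsum_cmult_right' infsum_cmult_left')
  then have "T * (1 - (\<Sum>\<^sub>\<infinity>n. z n)) = 1" by (simp add: algebra_simps)
  moreover have "(\<Sum>\<^sub>\<infinity>n. z n) \<noteq> 1"
    using norm_infsum_bound[OF z] s by auto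
  ultimately show "(\<Sum>\<^sub>\<infinity>w. monom_at z w) = 1 / (1 - (\<Sum>\<^sub>\<infinity>n. z n))"
    by (simp add: T_def[symmetric] field_simps)
qed

text \<open>
  The Cauchy product over words. Pairs of words are grouped by their concatenation.
\<close>

lemma infsum_conv:
  assumes a: "(\<lambda>w. cmod (a w)) summable_on UNIV" and b: "(\<lambda>w. cmod (b w)) summable_on UNIV"
  shows "(\<Sum>\<^sub>\<infinity>v. conv a b v) = (\<Sum>\<^sub>\<infinity>w. a w) * (\<Sum>\<^sub>\<infinity>w. b w)"
proof -
  define f where "f = (\<lambda>(p, q). a p * b q)"
  have "(\<lambda>z. norm (f z)) summable_on UNIV \<times> UNIV"
  proof (subst Infinite_Sum.abs_summable_on_Sigma_iff, intro conjI ballI)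
    show "(\<lambda>q. norm (f (p, q))) summable_on UNIV" for p
      using b by (auto simp: f_def norm_mult intro: summable_on_cmult_right)
    have "norm (\<Sum>\<^sub>\<infinity>q. norm (f (p, q))) = cmod (a p) * (\<Sum>\<^sub>\<infinity>q. cmod (b q))" for p
      by (simp add: f_def norm_mult infsum_cmult_right' infsum_nonneg)
    then show "(\<lambda>p. norm (\<Sum>\<^sub>\<infinity>q. norm (f (p, q)))) summable_on UNIV"
      using summable_on_cmult_left[OF a] by (simp only:)
  qed
  then have f: "f summable_on UNIV \<times> UNIV" by (rule abs_summable_summable)
  define S where "S = (\<lambda>v. {(p, q). p @ q = (v :: 'a list)})"
  have bij: "bij_betw (\<lambda>(v, z). z) (Sigma UNIV S) (UNIV \<times> UNIV)"
    by (rule bij_betwI[where g = "\<lambda>(p, q). (p @ q, (p, q))"]) (auto simp: S_def)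
  have f': "(\<lambda>(v, z). f z) summable_on Sigma UNIV S"
    using summable_on_reindex_bij_betw[OF bij, of f] f by (simp add: case_prod_unfold)
  have "(\<Sum>\<^sub>\<infinity>v. conv a b v) = (\<Sum>\<^sub>\<infinity>v. \<Sum>\<^sub>\<infinity>z\<in>S v. f z)"
    unfolding conv_def S_def f_def by (simp add: infsum_finite[OF finite_splits])
  also have "\<dots> = (\<Sum>\<^sub>\<infinity>(v, z)\<in>Sigma UNIV S. f z)"
    by (rule infsum_Sigma'_banach[OF f'])
  also have "\<dots> = infsum f (UNIV \<times> UNIV)"
    using infsum_reindex_bij_betw[OF bij, of f] by (simp add: case_prod_unfold)
  also have "\<dots> = (\<Sum>\<^sub>\<infinity>p. \<Sum>\<^sub>\<infinity>q. a p * b q)"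
    using infsum_Sigma_banach[OF f] by (simp add: f_def)
  also have "\<dots> = (\<Sum>\<^sub>\<infinity>w. a w) * (\<Sum>\<^sub>\<infinity>w. b w)"
    by (simp add: infsum_cmult_right' infsum_cmult_left')
  finally show ?thesis .
qed

definition eval_at :: "('b \<Rightarrow> complex) \<Rightarrow> ('b list \<Rightarrow> complex) \<Rightarrow> complex" where
  "eval_at z F = (\<Sum>\<^sub>\<infinity>w. F w * monom_at z w)"

text \<open>
  Here the variables become commuting numbers; since \<open>conv F G\<close> may fail to be in \<open>l\<^sup>2\<close>, the
  argument is absolute convergence and not continuity.
\<close>

lemma eval_at_conv:
  assumes z: "monom_at z \<in> l2" and F: "F \<in> l2" and G: "G \<in> l2"
  shows "eval_at z (conv F G) = eval_at z F * eval_at z G"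
proof -
  have "conv F G v * monom_at z v = conv (\<lambda>w. F w * monom_at z w) (\<lambda>w. G w * monom_at z w) v" for v
    unfolding conv_def sum_distrib_right by (rule sum.cong) (auto simp: mult_ac)
  then show ?thesis
    unfolding eval_at_def
    by (simp add: infsum_conv[OF l2_mult_summable[OF F z] l2_mult_summable[OF G z]])
qed

section \<open>Sequences as a single element of the Fock space\<close>

lemma slices_l2:
  assumes g: "g \<in> l2"
  shows "(\<lambda>w. g (n # w)) \<in> l2"
    and "summable (\<lambda>n::nat. (l2_norm (\<lambda>w. g (n # w)))\<^sup>2)"
    and "(\<Sum>n. (l2_norm (\<lambda>w. g (n # w)))\<^sup>2) \<le> (l2_norm g)\<^sup>2"
proof -
  have s: "(\<lambda>v. (cmod (g v))\<^sup>2) summable_on UNIV" using g by (simp add: l2_def)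
  then have s2: "(\<lambda>(n, w). (cmod (g (n # w)))\<^sup>2) summable_on UNIV \<times> UNIV"
    by (simp only: summable_on_lists_iff[of "\<lambda>v. (cmod (g v))\<^sup>2"])
  show slice: "(\<lambda>w. g (n # w)) \<in> l2" for n
    unfolding l2_def using summable_on_SigmaD1[OF s2, of n] by simp
  have so: "(\<lambda>n. (l2_norm (\<lambda>w. g (n # w)))\<^sup>2) summable_on UNIV"
    unfolding l2_norm_sq[OF slice] using summable_on_Sigma_banach[OF s2] by simp
  then show "summable (\<lambda>n. (l2_norm (\<lambda>w. g (n # w)))\<^sup>2)" by (rule summable_on_imp_summable)
  have "(\<Sum>n. (l2_norm (\<lambda>w. g (n # w)))\<^sup>2) = (\<Sum>\<^sub>\<infinity>n. (l2_norm (\<lambda>w. g (n # w)))\<^sup>2)"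
    using has_sum_imp_sums[OF has_sum_infsum[OF so]] by (simp add: sums_iff)
  also have "\<dots> \<le> (l2_norm g)\<^sup>2"
    unfolding l2_norm_sq[OF slice] l2_norm_sq[OF g] infsum_lists[OF s] by simp
  finally show "(\<Sum>n. (l2_norm (\<lambda>w. g (n # w)))\<^sup>2) \<le> (l2_norm g)\<^sup>2" .
qed

text \<open>
  The converse assembly. With \<open>g [] = 0\<close> the squared norms of the slices add up exactly.
\<close>

lemma stack_l2:
  assumes g: "\<And>n. (\<lambda>w. g (n # w)) \<in> l2" and g0: "g [] = 0"
    and s: "summable (\<lambda>n::nat. (l2_norm (\<lambda>w. g (n # w)))\<^sup>2)"
  shows "g \<in> l2" and "(l2_norm g)\<^sup>2 = (\<Sum>n. (l2_norm (\<lambda>w. g (n # w)))\<^sup>2)"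
proof -
  have so: "(\<lambda>n. (l2_norm (\<lambda>w. g (n # w)))\<^sup>2) summable_on UNIV"
    by (rule summable_nonneg_imp_summable_on[OF s]) simp
  have "(\<lambda>(n, w). (cmod (g (n # w)))\<^sup>2) summable_on UNIV \<times> UNIV"
  proof (rule summable_on_SigmaI)
    show "((\<lambda>w. case (n, w) of (n, w) \<Rightarrow> (cmod (g (n # w)))\<^sup>2) has_sum (l2_norm (\<lambda>w. g (n # w)))\<^sup>2) UNIV" for n
      unfolding l2_norm_sq[OF g] using g[of n] by (simp add: l2_def)
  qed (use so in auto)
  then have s1: "(\<lambda>v. (cmod (g v))\<^sup>2) summable_on UNIV"
    by (simp only: summable_on_lists_iff[of "\<lambda>v. (cmod (g v))\<^sup>2"])
  then show gl: "g \<in> l2" by (simp add: l2_def)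
  have "(l2_norm g)\<^sup>2 = (\<Sum>\<^sub>\<infinity>n. (l2_norm (\<lambda>w. g (n # w)))\<^sup>2)"
    unfolding l2_norm_sq[OF g] l2_norm_sq[OF gl] infsum_lists[OF s1] by (simp add: g0)
  also have "\<dots> = (\<Sum>n. (l2_norm (\<lambda>w. g (n # w)))\<^sup>2)"
    using has_sum_imp_sums[OF has_sum_infsum[OF so]] by (simp add: sums_iff)
  finally show "(l2_norm g)\<^sup>2 = (\<Sum>n. (l2_norm (\<lambda>w. g (n # w)))\<^sup>2)" .
qed

section \<open>A complete Pick space as a quotient of the Fock space\<close>

text \<open>
  The expansion of the kernel. The letter sums \<open>\<Sum>n. \<bar>y n * z n\<bar>\<close> stay below 1 by the inequality
  between arithmetic and geometric means, which is where the open ball is used.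
\<close>

lemma ball_kernel_sum:
  assumes y: "y \<in> l2" "l2_norm y < 1" and z: "z \<in> l2" "l2_norm z < 1"
  shows "(\<lambda>w. cmod (monom_at (\<lambda>n. y n * cnj (z n)) w)) summable_on UNIV"
    and "(\<Sum>\<^sub>\<infinity>w. monom_at (\<lambda>n. y n * cnj (z n)) w) = 1 / (1 - l2_ip y z)"
proof -
  have s: "(\<lambda>n. cmod (y n * cnj (z n))) summable_on UNIV"
    by (rule l2_mult_summable[OF y(1) l2_cnj[OF z(1)]])
  have sq: "(\<lambda>n. (cmod (y n))\<^sup>2) summable_on UNIV" "(\<lambda>n. (cmod (z n))\<^sup>2) summable_on UNIV"
    using y z by (auto simp: l2_def)
  have sq_less: "(\<Sum>\<^sub>\<infinity>n. (cmod (y n))\<^sup>2) < 1" "(\<Sum>\<^sub>\<infinity>n. (cmod (z n))\<^sup>2) < 1"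
    using power_strict_mono[OF y(2) l2_norm_nonneg[OF y(1)], of 2]
      power_strict_mono[OF z(2) l2_norm_nonneg[OF z(1)], of 2]
    by (simp_all add: l2_norm_sq[OF y(1)] l2_norm_sq[OF z(1)])
  have "2 * (\<Sum>\<^sub>\<infinity>n. cmod (y n * cnj (z n))) = (\<Sum>\<^sub>\<infinity>n. 2 * cmod (y n * cnj (z n)))"
    by (rule infsum_cmult_right'[symmetric])
  also have "\<dots> \<le> (\<Sum>\<^sub>\<infinity>n. (cmod (y n))\<^sup>2 + (cmod (z n))\<^sup>2)"
  proof (rule infsum_mono)
    show "2 * cmod (y n * cnj (z n)) \<le> (cmod (y n))\<^sup>2 + (cmod (z n))\<^sup>2" for n
      using sum_squares_bound[of "cmod (y n)" "cmod (z n)"] by (simp add: norm_mult)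
  qed (use s sq in \<open>auto intro: summable_on_add summable_on_cmult_right\<close>)
  also have "\<dots> = (\<Sum>\<^sub>\<infinity>n. (cmod (y n))\<^sup>2) + (\<Sum>\<^sub>\<infinity>n. (cmod (z n))\<^sup>2)"
    by (rule infsum_add[OF sq])
  finally have "(\<Sum>\<^sub>\<infinity>n. cmod (y n * cnj (z n))) < 1" using sq_less by linarith
  from words_geometric_series[OF s this]
  show "(\<lambda>w. cmod (monom_at (\<lambda>n. y n * cnj (z n)) w)) summable_on UNIV"
    and "(\<Sum>\<^sub>\<infinity>w. monom_at (\<lambda>n. y n * cnj (z n)) w) = 1 / (1 - l2_ip y z)"
    by (simp_all add: l2_ip_def)
qed

lemma monom_at_l2:
  assumes "z \<in> l2" "l2_norm z < 1"
  shows "monom_at z \<in> l2"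
proof -
  have "cmod (monom_at (\<lambda>n. z n * cnj (z n)) w) = (cmod (monom_at z w))\<^sup>2" for w
    by (simp add: monom_at_mult monom_at_cnj norm_mult power2_eq_square)
  then show ?thesis using ball_kernel_sum(1)[OF assms assms] by (simp add: l2_def)
qed

text \<open>
  The coordinates of \<open>u\<close> range over an arbitrary type, so a finite-dimensional ball is treated by
  extending \<open>u\<close> with zero coordinates.
\<close>

locale cnp_space = hilbert_fun \<Omega> H ip
  for \<Omega> :: "'a set" and H :: "('a \<Rightarrow> complex) set"
    and ip :: "('a \<Rightarrow> complex) \<Rightarrow> ('a \<Rightarrow> complex) \<Rightarrow> complex" +
  fixes k :: "'a \<Rightarrow> 'a \<Rightarrow> complex" and u :: "'a \<Rightarrow> 'b \<Rightarrow> complex"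
  assumes kernel_in: "y \<in> \<Omega> \<Longrightarrow> kernel_function \<Omega> k y \<in> H"
    and reproducing: "y \<in> \<Omega> \<Longrightarrow> f \<in> H \<Longrightarrow> f y = ip f (kernel_function \<Omega> k y)"
    and u_l2: "x \<in> \<Omega> \<Longrightarrow> u x \<in> l2" and u_ball: "x \<in> \<Omega> \<Longrightarrow> l2_norm (u x) < 1"
    and kernel_eq: "x \<in> \<Omega> \<Longrightarrow> y \<in> \<Omega> \<Longrightarrow> k x y = 1 / (1 - l2_ip (u x) (u y))"
begin

text \<open>
  Evaluation along \<open>u\<close>: the abelianization of a non-commutative power series, as a function
  on \<open>\<Omega>\<close>. At a point of \<open>\<Omega>\<close> it is the inner product with the conjugated monomials,
  the lifted kernel.
\<close>

definition descend :: "('b list \<Rightarrow> complex) \<Rightarrow> 'a \<Rightarrow> complex" where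
  "descend F x = (if x \<in> \<Omega> then eval_at (u x) F else 0)"

definition lifted_kernel :: "'a \<Rightarrow> 'b list \<Rightarrow> complex" where
  "lifted_kernel x w = cnj (monom_at (u x) w)"

lemma monom_u_l2: "x \<in> \<Omega> \<Longrightarrow> monom_at (u x) \<in> l2"
  by (rule monom_at_l2[OF u_l2 u_ball])

lemma lifted_kernel_l2: "x \<in> \<Omega> \<Longrightarrow> lifted_kernel x \<in> l2"
  using l2_cnj[OF monom_u_l2] by (simp add: lifted_kernel_def[abs_def])

lemma eval_at_ip: "eval_at (u x) F = l2_ip F (lifted_kernel x)"
  by (simp add: eval_at_def l2_ip_def lifted_kernel_def)

lemma lifted_kernel_gram:
  assumes x: "x \<in> \<Omega>" and y: "y \<in> \<Omega>"
  shows "l2_ip (lifted_kernel y) (lifted_kernel x)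
    = ip (kernel_function \<Omega> k y) (kernel_function \<Omega> k x)"
proof -
  have "l2_ip (lifted_kernel y) (lifted_kernel x)
      = (\<Sum>\<^sub>\<infinity>w. monom_at (\<lambda>n. u x n * cnj (u y n)) w)"
    by (simp add: l2_ip_def lifted_kernel_def monom_at_mult monom_at_cnj mult.commute)
  also have "\<dots> = k x y"
    by (simp add: ball_kernel_sum(2)[OF u_l2[OF x] u_ball[OF x] u_l2[OF y] u_ball[OF y]]
        kernel_eq[OF x y])
  also have "\<dots> = ip (kernel_function \<Omega> k y) (kernel_function \<Omega> k x)"
    using reproducing[OF x kernel_in[OF y]] x by (simp add: kernel_function_def)
  finally show ?thesis .
qed

lemma descend_eqI:
  assumes "g \<in> H" and "\<And>x. x \<in> \<Omega> \<Longrightarrow> l2_ip F (lifted_kernel x) = ip g (kernel_function \<Omega> k x)"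
  shows "descend F = g"
proof
  fix x show "descend F x = g x"
    using assms reproducing[OF _ assms(1)] in_functions_on[OF assms(1)]
    by (cases "x \<in> \<Omega>") (auto simp: descend_def eval_at_ip functions_on_def)
qed

text \<open>
  This and \<open>contractive_lift\<close> are the two directions of the Gram transfer between the lifted kernels
  and the kernel functions: together they say that \<open>H\<close> is a quotient of \<open>l\<^sup>2\<close>.
\<close>

lemma descend_contraction:
  assumes F: "F \<in> l2"
  shows "descend F \<in> H" and "hs_norm ip (descend F) \<le> l2_norm F"
proof -
  obtain g where g: "g \<in> H"
    "\<And>x. x \<in> \<Omega> \<Longrightarrow> ip g (kernel_function \<Omega> k x) = l2_ip F (lifted_kernel x)"
    "hs_norm ip g \<le> l2_norm F"
    using gram_transfer[OF l2.hilbert_fun_axioms hilbert_fun_axioms,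
        of \<Omega> lifted_kernel "kernel_function \<Omega> k" F] lifted_kernel_l2 kernel_in lifted_kernel_gram F
    by metis
  have "descend F = g" by (rule descend_eqI[OF g(1)]) (simp add: g(2))
  then show "descend F \<in> H" and "hs_norm ip (descend F) \<le> l2_norm F" using g by auto
qed

lemma contractive_lift:
  assumes g: "g \<in> H"
  obtains G where "G \<in> l2" "descend G = g" "l2_norm G \<le> hs_norm ip g"
proof -
  obtain G where G: "G \<in> l2"
    "\<And>x. x \<in> \<Omega> \<Longrightarrow> l2_ip G (lifted_kernel x) = ip g (kernel_function \<Omega> k x)"
    "l2_norm G \<le> hs_norm ip g"
    using gram_transfer[OF hilbert_fun_axioms l2.hilbert_fun_axioms,
        of \<Omega> "kernel_function \<Omega> k" lifted_kernel g] lifted_kernel_l2 kernel_in lifted_kernel_gram g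
    by metis
  then show ?thesis using that descend_eqI[OF g] by blast
qed

lemma descend_conv: "F \<in> l2 \<Longrightarrow> G \<in> l2 \<Longrightarrow> descend (conv F G) = (\<lambda>x. descend F x * descend G x)"
  by (auto simp: descend_def eval_at_conv[OF monom_u_l2])

lemma descend_diff: "F \<in> l2 \<Longrightarrow> G \<in> l2 \<Longrightarrow> descend (\<lambda>w. F w - G w) = (\<lambda>x. descend F x - descend G x)"
  by (auto simp: descend_def eval_at_ip l2.ip_diff lifted_kernel_l2)

text \<open>
  Left convolution by \<open>F\<close> acting on lifts is multiplication by \<open>descend F\<close> on \<open>H\<close>.
\<close>

lemma descend_multiplier:
  assumes "F \<in> l2" and "\<And>G. G \<in> l2 \<Longrightarrow> conv F G \<in> l2"
  shows "descend F \<in> multipliers \<Omega> H"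
  unfolding multipliers_def functions_on_def
proof (intro CollectI conjI ballI)
  fix g assume "g \<in> H"
  then obtain G where "G \<in> l2" "descend G = g" using contractive_lift by metis
  then show "(\<lambda>x. descend F x * g x) \<in> H"
    using descend_contraction(1)[of "conv F G"] assms by (simp add: descend_conv)
qed (simp add: descend_def)

text \<open>
  For a polynomial it is right convolution that is known to preserve \<open>l\<^sup>2\<close>. After descending the
  side no longer matters.
\<close>

lemma descend_poly_multiplier:
  assumes b: "b \<in> polys"
  shows "descend b \<in> multipliers \<Omega> H"
  unfolding multipliers_def functions_on_def
proof (intro CollectI conjI ballI)
  fix g assume "g \<in> H"
  then obtain G where "G \<in> l2" "descend G = g" using contractive_lift by metis
  then show "(\<lambda>x. descend b x * g x) \<in> H"
    using descend_contraction(1)[OF conv_poly_l2[OF b \<open>G \<in> l2\<close>]] polys_l2[OF b]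
    by (simp add: descend_conv mult.commute)
qed (simp add: descend_def)

text \<open>
  Right multiples of \<open>F\<close> reach the constant, hence all polynomials, hence everything in \<open>l\<^sup>2\<close>.
  Descending the approximations gives multiples of \<open>descend F\<close> by multipliers.
\<close>

lemma descend_cyclic:
  assumes F: "F \<in> l2" and outer: "delta [] \<in> cyclic_subspace F"
  shows "cyclic_vector \<Omega> H ip (descend F)"
  unfolding cyclic_vector_def
proof (intro conjI ballI allI impI descend_contraction(1)[OF F])
  fix g and e :: real assume g: "g \<in> H" and e: "e > 0"
  obtain G where G: "G \<in> l2" "descend G = g" using contractive_lift[OF g] by metis
  obtain p where p: "p \<in> polys" "l2_norm (\<lambda>v. G v - p v) < e / 2"
    using polys_dense[OF G(1), of "e/2"] e by auto
  have "conv (delta []) p \<in> cyclic_subspace F" by (rule cyclic_subspace_conv[OF F outer p(1)])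
  then obtain b where b: "b \<in> polys" "l2_norm (\<lambda>v. p v - conv F b v) < e / 2"
    using cyclic_subspaceD[of p F "e/2"] e by (auto simp: conv_delta_left_Nil)
  have Fb: "conv F b \<in> l2" by (rule conv_poly_l2[OF b(1) F])
  have "hs_norm ip (\<lambda>x. g x - descend b x * descend F x) = hs_norm ip (descend (\<lambda>v. G v - conv F b v))"
    by (simp add: descend_diff[OF G(1) Fb] descend_conv[OF F polys_l2[OF b(1)]] G(2) mult.commute)
  also have "\<dots> \<le> l2_norm (\<lambda>v. G v - conv F b v)"
    by (rule descend_contraction(2)[OF l2.diff_in[OF G(1) Fb]])
  also have "\<dots> \<le> l2_norm (\<lambda>v. G v - p v) + l2_norm (\<lambda>v. p v - conv F b v)"
    by (rule l2.nrm_dist_triangle[OF G(1) polys_l2[OF p(1)] Fb])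
  also have "\<dots> < e" using p(2) b(2) by simp
  finally show "\<exists>\<phi>\<in>multipliers \<Omega> H. hs_norm ip (\<lambda>x. g x - \<phi> x * descend F x) < e"
    using descend_poly_multiplier[OF b(1)] by blast
qed

end

lemma rkhs_cnp_space:
  assumes "normalized_cnp_kernel \<Omega> k" and rk: "rkhs \<Omega> k H ip"
  obtains u :: "'a \<Rightarrow> nat \<Rightarrow> complex" where "cnp_space \<Omega> H ip k u"
proof -
  obtain d u0 where ball: "maps_to_ball \<Omega> d u0"
    and k: "\<And>x y. x \<in> \<Omega> \<Longrightarrow> y \<in> \<Omega> \<Longrightarrow>
      k x y = 1 / (1 - (\<Sum>\<^sub>\<infinity>n\<in>{n. enat n < d}. u0 x n * cnj (u0 y n)))"
    using assms(1) unfolding normalized_cnp_kernel_def by blast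
  define u where "u x n = (if enat n < d then u0 x n else 0)" for x n
  have ip_u: "l2_ip (u x) (u y) = (\<Sum>\<^sub>\<infinity>n\<in>{n. enat n < d}. u0 x n * cnj (u0 y n))" for x y
    unfolding l2_ip_def by (rule infsum_cong_neutral) (auto simp: u_def)
  have u_l2: "u x \<in> l2" if "x \<in> \<Omega>" for x
  proof -
    have "(\<lambda>n. (cmod (u x n))\<^sup>2) summable_on UNIV
        \<longleftrightarrow> (\<lambda>n. (cmod (u0 x n))\<^sup>2) summable_on {n. enat n < d}"
      by (rule summable_on_cong_neutral) (auto simp: u_def)
    then show ?thesis using ball that by (simp add: l2_def maps_to_ball_def)
  qed
  have u_norm: "l2_norm (u x) < 1" if x: "x \<in> \<Omega>" for x
  proof -
    have "(l2_norm (u x))\<^sup>2 = (\<Sum>\<^sub>\<infinity>n\<in>{n. enat n < d}. (cmod (u0 x n))\<^sup>2)"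
      unfolding l2_norm_sq[OF u_l2[OF x]] by (rule infsum_cong_neutral) (auto simp: u_def)
    then have "(l2_norm (u x))\<^sup>2 < 1\<^sup>2" using ball x by (simp add: maps_to_ball_def)
    then show ?thesis by (rule power2_less_imp_less) simp
  qed
  have "cnp_space \<Omega> H ip k u"
  proof
    show "hilbert_function_space \<Omega> H ip" using rk by (simp add: rkhs_def)
  qed (use rk k u_l2 u_norm in \<open>auto simp: rkhs_def ip_u\<close>)
  then show ?thesis by (rule that)
qed

section \<open>The factorization of a square-summable sequence\<close>

theorem theorem1p1:
  fixes \<Omega> :: "'a set"
    and k :: "'a \<Rightarrow> 'a \<Rightarrow> complex"
    and H :: "('a \<Rightarrow> complex) set"
    and ip :: "('a \<Rightarrow> complex) \<Rightarrow> ('a \<Rightarrow> complex) \<Rightarrow> complex"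
    and f :: "nat \<Rightarrow> 'a \<Rightarrow> complex"
  assumes "normalized_cnp_kernel \<Omega> k"
    and "rkhs \<Omega> k H ip"
    and "\<And>n. f n \<in> H"
    and "summable (\<lambda>n. (hs_norm ip (f n))\<^sup>2)"
    and "\<exists>n. f n \<noteq> (\<lambda>x. 0)"
  shows "\<exists>(\<phi> :: nat \<Rightarrow> 'a \<Rightarrow> complex) F.
    (\<forall>n. \<phi> n \<in> multipliers \<Omega> H) \<and>
    cyclic_vector \<Omega> H ip F \<and>
    (hs_norm ip F)\<^sup>2 \<le> (\<Sum>n. (hs_norm ip (f n))\<^sup>2) \<and>
    contractive_column H ip \<phi> \<and>
    (\<forall>n. f n = (\<lambda>x. \<phi> n x * F x))"
proof -
  obtain u :: "'a \<Rightarrow> nat \<Rightarrow> complex" where "cnp_space \<Omega> H ip k u"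
    using rkhs_cnp_space[OF assms(1,2)] .
  then interpret cnp_space \<Omega> H ip k u .
  have "\<exists>a. a \<in> l2 \<and> descend a = f n \<and> l2_norm a \<le> hs_norm ip (f n)" for n
    using contractive_lift[OF assms(3)[of n]] by metis
  then obtain a where a: "\<And>n. a n \<in> l2" "\<And>n. descend (a n) = f n"
    "\<And>n. l2_norm (a n) \<le> hs_norm ip (f n)" by metis
  \<comment> \<open>The value at the empty word is padding: only the words with a first letter carry data.\<close>
  define A where "A v = (case v of [] \<Rightarrow> 0 | n # w \<Rightarrow> a n w)" for v
  have slice: "(\<lambda>w. A (n # w)) = a n" for n by (simp add: A_def)
  have A0: "A [] = 0" by (simp add: A_def)
  have a_le: "(l2_norm (a n))\<^sup>2 \<le> (hs_norm ip (f n))\<^sup>2" for n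
    by (rule power_mono[OF a(3) l2.nrm_nonneg[OF a(1)]])
  have a_sum: "summable (\<lambda>n. (l2_norm (a n))\<^sup>2)"
    by (rule summable_comparison_test'[OF assms(4), of 0]) (simp add: a_le)
  have A: "A \<in> l2" and A_norm: "(l2_norm A)\<^sup>2 = (\<Sum>n. (l2_norm (a n))\<^sup>2)"
    using stack_l2[of A] by (simp_all add: slice a(1) A0 a_sum)
  have "A \<noteq> (\<lambda>v. 0)"
  proof
    assume "A = (\<lambda>v. 0)"
    then have "a n = (\<lambda>w. 0)" for n using slice[of n] by simp
    moreover have "descend (\<lambda>w. 0) = (\<lambda>x. 0)" by (auto simp: descend_def eval_at_def)
    ultimately have "f n = (\<lambda>x. 0)" for n using a(2)[of n] by simp
    then show False using assms(5) by blast
  qed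
  then obtain \<theta> F where inn: "inner_function \<theta>" and F: "F \<in> l2" and fac: "conv \<theta> F = A"
    and outer: "delta [] \<in> cyclic_subspace F"
    using inner_outer_factorization[OF A] by blast
  have F0: "F [] \<noteq> 0"
  proof
    assume F0: "F [] = 0"
    obtain b where b: "b \<in> polys" "l2_norm (\<lambda>v. delta [] v - conv F b v) < 1"
      using cyclic_subspaceD[OF outer, of 1] by auto
    have "cmod (1 - F [] * b []) \<le> l2_norm (\<lambda>v. delta [] v - conv F b v)"
      using l2_coord_le[OF l2.diff_in[OF delta_l2[of "[]"] conv_poly_l2[OF b(1) F]], of "[]"]
      by (simp add: delta_def[of "[]" "[]"])
    then show False using b(2) F0 by simp
  qed
  \<comment> \<open>Outerness prevents \<open>F\<close> from vanishing at \<open>[]\<close>, so \<open>\<theta>\<close> inherits the zero of \<open>A\<close>. Without it,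
    the slices of \<open>conv \<theta> G\<close> would not be the convolutions of the slices of \<open>\<theta>\<close> with \<open>G\<close>.\<close>
  then have th0: "\<theta> [] = 0" using fac A0 by (metis conv_Nil mult_eq_0_iff)
  define \<theta>s where "\<theta>s n = (\<lambda>w. \<theta> (n # w))" for n
  have slice_conv: "(\<lambda>w. conv \<theta> G (n # w)) = conv (\<theta>s n) G" for G n
    by (simp add: conv_Cons th0 \<theta>s_def)
  have \<theta>_l2: "\<theta> \<in> l2" using inn by (simp add: inner_function_def)
  have \<theta>s_l2: "\<theta>s n \<in> l2" for n unfolding \<theta>s_def by (rule slices_l2(1)[OF \<theta>_l2])
  have \<theta>s_conv: "conv (\<theta>s n) G \<in> l2" if "G \<in> l2" for G n
    using slices_l2(1)[OF inner_function_isometry(1)[OF inn that], of n] by (simp add: slice_conv)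
  define \<phi> where "\<phi> n = descend (\<theta>s n)" for n
  have mult: "\<phi> n \<in> multipliers \<Omega> H" for n
    unfolding \<phi>_def by (rule descend_multiplier[OF \<theta>s_l2 \<theta>s_conv])
  have cyclic: "cyclic_vector \<Omega> H ip (descend F)" by (rule descend_cyclic[OF F outer])
  have "(hs_norm ip (descend F))\<^sup>2 \<le> (l2_norm F)\<^sup>2"
    by (rule power_mono[OF descend_contraction(2)[OF F] nrm_nonneg[OF descend_contraction(1)[OF F]]])
  also have "l2_norm F = l2_norm A" using inner_function_isometry(2)[OF inn F] fac by simp
  also have "(l2_norm A)\<^sup>2 \<le> (\<Sum>n. (hs_norm ip (f n))\<^sup>2)"
    unfolding A_norm by (rule suminf_le[OF a_le a_sum assms(4)])
  finally have norm_F: "(hs_norm ip (descend F))\<^sup>2 \<le> (\<Sum>n. (hs_norm ip (f n))\<^sup>2)" .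
  have fact: "f n = (\<lambda>x. \<phi> n x * descend F x)" for n
  proof -
    have "f n = descend (conv (\<theta>s n) F)" using slice[of n] slice_conv[of F n] a(2)[of n] by (simp add: fac)
    then show ?thesis by (simp add: descend_conv[OF \<theta>s_l2 F] \<phi>_def)
  qed
  have column: "contractive_column H ip \<phi>"
    unfolding contractive_column_def
  proof (rule ballI)
    fix g assume g: "g \<in> H"
    obtain G where G: "G \<in> l2" "descend G = g" "l2_norm G \<le> hs_norm ip g"
      using contractive_lift[OF g] by metis
    have \<phi>g: "(\<lambda>x. \<phi> n x * g x) = descend (conv (\<theta>s n) G)" for n
      by (simp add: descend_conv[OF \<theta>s_l2 G(1)] \<phi>_def G(2))
    have le: "(hs_norm ip (\<lambda>x. \<phi> n x * g x))\<^sup>2 \<le> (l2_norm (conv (\<theta>s n) G))\<^sup>2" for n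
      unfolding \<phi>g by (intro power_mono descend_contraction(2) nrm_nonneg descend_contraction(1) \<theta>s_conv G(1))
    have sum: "summable (\<lambda>n. (l2_norm (conv (\<theta>s n) G))\<^sup>2)"
      and sum_le: "(\<Sum>n. (l2_norm (conv (\<theta>s n) G))\<^sup>2) \<le> (l2_norm (conv \<theta> G))\<^sup>2"
      using slices_l2(2,3)[OF inner_function_isometry(1)[OF inn G(1)]] by (simp_all add: slice_conv)
    have sum': "summable (\<lambda>n. (hs_norm ip (\<lambda>x. \<phi> n x * g x))\<^sup>2)"
      by (rule summable_comparison_test'[OF sum, of 0]) (simp add: le)
    have "(\<Sum>n. (hs_norm ip (\<lambda>x. \<phi> n x * g x))\<^sup>2) \<le> (\<Sum>n. (l2_norm (conv (\<theta>s n) G))\<^sup>2)"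
      by (rule suminf_le[OF le sum' sum])
    also note sum_le
    also have "l2_norm (conv \<theta> G) = l2_norm G" by (rule inner_function_isometry(2)[OF inn G(1)])
    also have "(l2_norm G)\<^sup>2 \<le> (hs_norm ip g)\<^sup>2"
      by (rule power_mono[OF G(3) l2.nrm_nonneg[OF G(1)]])
    finally show "summable (\<lambda>n. (hs_norm ip (\<lambda>x. \<phi> n x * g x))\<^sup>2) \<and>
        (\<Sum>n. (hs_norm ip (\<lambda>x. \<phi> n x * g x))\<^sup>2) \<le> (hs_norm ip g)\<^sup>2"
      using sum' by blast
  qed
  show ?thesis using mult cyclic norm_F column fact by blast
qed

end
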